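(* Let $T \in \mathbb{N}$ and let $\boldsymbol{\nu}$ be a $K$-armed rising rested bandit with expected rewards $\boldsymbol{\mu}$ and $\sigma^2$-subgaussian rewards, $\sigma > 0$. Then the algorithm R-ed-UCB run with index $B_i(t) = \widehat{\mu}_i^{\mathrm{R\text{-}ed},h_{i,t}}(t) + \beta_i^{\mathrm{R\text{-}ed},h_{i,t}}(t,\delta_t)$, window sizes $h_{i,t} = \lfloor \epsilon N_{i,t-1} \rfloor$ for $\epsilon \in (0,1/2)$, and $\delta_t = t^{-\alpha}$ for $\alpha > 2$, suffers an expected regret bounded, for every $q \in [0,1]$, as $$R_{\boldsymbol{\mu}}(\text{R-ed-UCB},T) \le \mathcal{O}\!\left( \frac{K}{\epsilon} (\sigma T)^{\frac{2}{3}} (\alpha \log T)^{\frac{1}{3}} + \frac{K\, T^q}{1-2\epsilon}\, \Upsilon_{\boldsymbol{\mu}}\!\left(\left\lceil (1-2\epsilon) \frac{T}{K} \right\rceil, q\right) \right).$$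
   Context: Setting: $\mathbb{N} = \{1,2,\dots\}$, $[K] = \{1,\dots,K\}$. A rested $K$-armed bandit is a vector $\boldsymbol{\nu} = (\nu_i)_{i\in[K]}$ where each $\nu_i$ maps $n \in \mathbb{N}$ to a probability distribution $\nu_i(n)$ on $\mathbb{R}$. At each round $t \in [T]$ the agent selects an arm $I_t \in [K]$ and observes a reward $R_t \sim \nu_{I_t}(N_{I_t,t})$ (conditionally on the past and $I_t$), where $N_{i,t} = \sum_{l=1}^t \mathbf{1}\{I_l = i\}$ is the number of pulls of arm $i$ up to and including round $t$. The expected rewards are $\mu_i(n) = \mathbb{E}_{R\sim\nu_i(n)}[R] \in [0,1]$, $\boldsymbol{\mu} = (\mu_i)_{i \in [K]}$. Rewards are $\sigma^2$-subgaussian: $\mathbb{E}_{R\sim\nu_i(n)}[e^{\lambda(R-\mu_i(n))}] \le e^{\sigma^2\lambda^2/2}$ for all $\lambda \in \mathbb{R}$. A policy $\pi$ maps each history $(I_l,R_l)_{l=1}^{t-1}$ to an arm $I_t$; $J_{\boldsymbol{\mu}}(\pi,T) = \mathbb{E}_{\boldsymbol{\mu},\pi}\big[\sum_{t=1}^T \mu_{I_t}(N_{I_t,t})\big]$, and the expected cumulative regret is $R_{\boldsymbol{\mu}}(\pi,T) = \max_{\pi'} J_{\boldsymbol{\mu}}(\pi',T) - J_{\boldsymbol{\mu}}(\pi,T)$, with $\pi'$ ranging over all policies (including those that know $\boldsymbol{\mu}$). Increments: $\gamma_i(n) = \mu_i(n+1) - \mu_i(n)$. The bandit is rising if, for all $i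 \in [K]$ and $n \in \mathbb{N}$, $\gamma_i(n) \ge 0$ and $\gamma_i(n+1) \le \gamma_i(n)$. Cumulative increment: $\Upsilon_{\boldsymbol{\mu}}(M,q) = \sum_{l=1}^{M-1} \max_{i\in[K]} \{\gamma_i(l)^q\}$. Algorithm R-ed-UCB: at each round $t = 1,\dots,T$ it pulls an arm $I_t \in \arg\max_{i\in[K]} B_i(t)$. Let $t_{i,n}$ denote the round at which arm $i$ is pulled for the $n$-th time. For an integer window $1 \le h \le \lfloor N_{i,t-1}/2\rfloor$, $$\widehat{\mu}_i^{\mathrm{R\text{-}ed},h}(t) = \frac{1}{h}\sum_{l=N_{i,t-1}-h+1}^{N_{i,t-1}} \left( R_{t_{i,l}} + (t-l)\,\frac{R_{t_{i,l}} - R_{t_{i,l-h}}}{h} \right),$$ $$\beta_i^{\mathrm{R\text{-}ed},h}(t,\delta) = \sigma\,(t - N_{i,t-1} + h - 1)\sqrt{\frac{10 \log\frac{1}{\delta}}{h^3}},$$ while for $h = 0$ both quantities are $+\infty$. *)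

theory Defs
  imports "HOL-Probability.Probability"
begin

section \<open>Rested rising bandits\<close>

text \<open>
  The arms are the natural numbers in \<open>{1..K}\<close>, and \<open>\<nu> i n\<close> is the distribution of the reward of
  arm \<open>i\<close> at its \<open>n\<close>-th pull, for \<open>n \<ge> 1\<close>. Values outside these ranges are irrelevant.
\<close>

type_synonym bandit = "nat \<Rightarrow> nat \<Rightarrow> real measure"

definition mean_reward :: "bandit \<Rightarrow> nat \<Rightarrow> nat \<Rightarrow> real" where
  "mean_reward \<nu> i n = (\<integral>r. r \<partial>\<nu> i n)"

definition rested_bandit :: "nat \<Rightarrow> bandit \<Rightarrow> bool" where
  "rested_bandit K \<nu> \<longleftrightarrow> 1 \<le> K \<and>
     (\<forall>i\<in>{1..K}. \<forall>n\<ge>1. prob_space (\<nu> i n) \<and> sets (\<nu> i n) = sets borel \<and>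
        integrable (\<nu> i n) (\<lambda>r. r) \<and> mean_reward \<nu> i n \<in> {0..1})"

definition subgaussian_rewards :: "nat \<Rightarrow> bandit \<Rightarrow> real \<Rightarrow> bool" where
  "subgaussian_rewards K \<nu> \<sigma> \<longleftrightarrow>
     (\<forall>i\<in>{1..K}. \<forall>n\<ge>1. \<forall>x::real.
        integrable (\<nu> i n) (\<lambda>r. exp (x * (r - mean_reward \<nu> i n))) \<and>
        (\<integral>r. exp (x * (r - mean_reward \<nu> i n)) \<partial>\<nu> i n) \<le> exp (\<sigma>\<^sup>2 * x\<^sup>2 / 2))"

definition increment :: "bandit \<Rightarrow> nat \<Rightarrow> nat \<Rightarrow> real" where
  "increment \<nu> i n = mean_reward \<nu> i (n + 1) - mean_reward \<nu> i n"

definition rising :: "nat \<Rightarrow> bandit \<Rightarrow> bool" where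
  "rising K \<nu> \<longleftrightarrow> (\<forall>i\<in>{1..K}. \<forall>n\<ge>1.
     0 \<le> increment \<nu> i n \<and> increment \<nu> i (n + 1) \<le> increment \<nu> i n)"

text \<open>The case distinction implements \<open>0\<^sup>0 = 1\<close>; in HOL, \<open>0 powr 0 = 0\<close>.\<close>

definition cumulative_increment :: "nat \<Rightarrow> bandit \<Rightarrow> nat \<Rightarrow> real \<Rightarrow> real" where
  "cumulative_increment K \<nu> m q =
     (\<Sum>l\<in>{1..<m}. MAX i\<in>{1..K}. if q = 0 then 1 else increment \<nu> i l powr q)"


section \<open>Interaction between a policy and a bandit\<close>

text \<open>
  A history of \<open>n\<close> rounds is a function on \<open>{0..<n}\<close> whose value at \<open>s\<close> is the pair (arm, reward) of
  round \<open>s + 1\<close>. The offset comes from the library construction of the process below; the accessors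
  take the round, counted from 1.
\<close>

type_synonym history = "nat \<Rightarrow> nat \<times> real"

definition arm_at :: "history \<Rightarrow> nat \<Rightarrow> nat" where
  "arm_at h t = fst (h (t - 1))"

definition reward_at :: "history \<Rightarrow> nat \<Rightarrow> real" where
  "reward_at h t = snd (h (t - 1))"

definition pulls :: "history \<Rightarrow> nat \<Rightarrow> nat \<Rightarrow> nat" where
  "pulls h i t = card {l\<in>{1..t}. arm_at h l = i}"

definition pull_round :: "history \<Rightarrow> nat \<Rightarrow> nat \<Rightarrow> nat" where
  "pull_round h i n = (LEAST t. 1 \<le> t \<and> arm_at h t = i \<and> pulls h i t = n)"

definition round_space :: "nat \<Rightarrow> (nat \<times> real) measure" where
  "round_space K = count_space {1..K} \<Otimes>\<^sub>M borel"

definition history_space :: "nat \<Rightarrow> nat \<Rightarrow> history measure" where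
  "history_space K n = (\<Pi>\<^sub>M s\<in>{0..<n}. round_space K)"

text \<open>\<open>\<pi> n h\<close> is the arm selected in round \<open>n + 1\<close> after the history \<open>h\<close> of \<open>n\<close> rounds.\<close>

type_synonym policy = "nat \<Rightarrow> history \<Rightarrow> nat"

definition is_policy :: "nat \<Rightarrow> policy \<Rightarrow> bool" where
  "is_policy K \<pi> \<longleftrightarrow> (\<forall>n. \<pi> n \<in> history_space K n \<rightarrow>\<^sub>M count_space {1..K})"

text \<open>
  Conditional law of (arm, reward) in round \<open>n + 1\<close> given the history \<open>h\<close> of the first \<open>n\<close> rounds;
  the round itself counts as a pull of the selected arm.
\<close>

definition round_kernel :: "nat \<Rightarrow> bandit \<Rightarrow> policy \<Rightarrow> nat \<Rightarrow> history \<Rightarrow> (nat \<times> real) measure" where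
  "round_kernel K \<nu> \<pi> n h =
     (let i = \<pi> n h in distr (\<nu> i (pulls h i n + 1)) (round_space K) (\<lambda>r. (i, r)))"

lemma measurable_pulls: "(\<lambda>h. pulls h i n) \<in> history_space K n \<rightarrow>\<^sub>M count_space UNIV"
proof -
  have e: "pulls h i n = (\<Sum>l\<in>{1..n}. of_bool (fst (h (l-1)) = i))" for h
  proof -
    have "{l\<in>{1..n}. fst (h (l - 1)) = i} = {1..n} \<inter> {l. fst (h (l - 1)) = i}" by auto
    then show ?thesis by (simp add: pulls_def arm_at_def sum.If_cases of_bool_def)
  qed
  have "(\<lambda>h. (of_bool (fst (h (l-1)) = i)::nat)) \<in> history_space K n \<rightarrow>\<^sub>M count_space UNIV"
    if "l\<in>{1..n}" for l
  proof -
    have c: "(\<lambda>h. h (l-1)) \<in> history_space K n \<rightarrow>\<^sub>M round_space K"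
      unfolding history_space_def using that by (intro measurable_component_singleton) auto
    have "(\<lambda>x. fst x) \<in> round_space K \<rightarrow>\<^sub>M count_space {1..K}" unfolding round_space_def by simp
    from measurable_compose[OF c this] have d:
       "(\<lambda>h. fst (h (l-1))) \<in> history_space K n \<rightarrow>\<^sub>M count_space {1..K}" .
    show ?thesis by (rule measurable_compose[OF d]) simp
  qed
  then show ?thesis unfolding e by (intro measurable_sum_nat) auto
qed

lemma Ionescu_Tulcea_round_kernel:
  assumes "rested_bandit K \<nu>" "is_policy K \<pi>"
  shows "Ionescu_Tulcea (round_kernel K \<nu> \<pi>) (\<lambda>_. round_space K)"
proof -
  have ps: "prob_space (distr (\<nu> i (k+1)) (round_space K) (\<lambda>r. (i, r)))" if "i\<in>{1..K}" for i k
  proof -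
    from assms(1) that have p: "prob_space (\<nu> i (k+1))"
      and s[measurable_cong]: "sets (\<nu> i (k+1)) = sets borel"
      by (auto simp: rested_bandit_def)
    show ?thesis
      unfolding round_space_def using that by (intro prob_space.prob_space_distr[OF p]) measurable
  qed
  have pn: "\<pi> n \<in> history_space K n \<rightarrow>\<^sub>M count_space {1..K}" for n
    using assms by (auto simp: is_policy_def)
  have "round_kernel K \<nu> \<pi> n \<in> history_space K n \<rightarrow>\<^sub>M subprob_algebra (round_space K)" for n
    unfolding round_kernel_def Let_def
  proof (rule measurable_compose_countable'[OF _ pn])
    fix i assume i: "i\<in>{1..K}"
    show "(\<lambda>h. distr (\<nu> i (pulls h i n + 1)) (round_space K) (Pair i))
      \<in> history_space K n \<rightarrow>\<^sub>M subprob_algebra (round_space K)"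
      by (rule measurable_compose[OF measurable_pulls[of i]])
        (use ps[OF i] in \<open>auto simp: space_subprob_algebra prob_space_imp_subprob_space\<close>)
  qed simp
  moreover have "prob_space (round_kernel K \<nu> \<pi> n h)" if "h \<in> space (history_space K n)" for n h
    unfolding round_kernel_def Let_def using measurable_space[OF pn that] by (intro ps) auto
  ultimately show ?thesis
    unfolding history_space_def by (intro Ionescu_Tulcea.intro) auto
qed

text \<open>Joint law of the first \<open>T\<close> rounds, obtained by composing the kernels.\<close>

definition history_law :: "nat \<Rightarrow> bandit \<Rightarrow> policy \<Rightarrow> nat \<Rightarrow> history measure" where
  "history_law K \<nu> \<pi> T =
     Ionescu_Tulcea.C (round_kernel K \<nu> \<pi>) (\<lambda>_. round_space K) 0 T (\<lambda>_. undefined)"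

definition expected_return :: "nat \<Rightarrow> bandit \<Rightarrow> policy \<Rightarrow> nat \<Rightarrow> real" where
  "expected_return K \<nu> \<pi> T =
     (\<integral>h. (\<Sum>t\<in>{1..T}. mean_reward \<nu> (arm_at h t) (pulls h (arm_at h t) t))
        \<partial>history_law K \<nu> \<pi> T)"

text \<open>
  The supremum ranges over policies that may depend on \<open>\<nu>\<close>; the returns lie in \<open>[0, T]\<close>.
\<close>

definition regret :: "nat \<Rightarrow> bandit \<Rightarrow> policy \<Rightarrow> nat \<Rightarrow> real" where
  "regret K \<nu> \<pi> T =
     (SUP \<pi>'\<in>{\<pi>'. is_policy K \<pi>'}. expected_return K \<nu> \<pi>' T) - expected_return K \<nu> \<pi> T"


section \<open>R-ed-UCB\<close>

definition red_estimator :: "nat \<Rightarrow> nat \<Rightarrow> nat \<Rightarrow> history \<Rightarrow> ereal" where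
  "red_estimator w i t h =
     (if w = 0 then \<infinity> else
        (let N = pulls h i (t - 1); X = (\<lambda>l. reward_at h (pull_round h i l)) in
         ereal (1 / real w *
           (\<Sum>l\<in>{N - w + 1..N}. X l + (real t - real l) * ((X l - X (l - w)) / real w)))))"

definition red_bonus :: "real \<Rightarrow> nat \<Rightarrow> nat \<Rightarrow> nat \<Rightarrow> real \<Rightarrow> history \<Rightarrow> ereal" where
  "red_bonus \<sigma> w i t \<delta> h =
     (if w = 0 then \<infinity> else
        ereal (\<sigma> * (real t - real (pulls h i (t - 1)) + real w - 1) *
               sqrt (10 * ln (1 / \<delta>) / real w ^ 3)))"

definition red_window :: "real \<Rightarrow> nat \<Rightarrow> nat \<Rightarrow> history \<Rightarrow> nat" where
  "red_window \<epsilon> i t h = nat \<lfloor>\<epsilon> * real (pulls h i (t - 1))\<rfloor>"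

definition red_index :: "real \<Rightarrow> real \<Rightarrow> real \<Rightarrow> nat \<Rightarrow> nat \<Rightarrow> history \<Rightarrow> ereal" where
  "red_index \<sigma> \<epsilon> \<alpha> i t h =
     (let w = red_window \<epsilon> i t h
      in red_estimator w i t h + red_bonus \<sigma> w i t (real t powr - \<alpha>) h)"

text \<open>Ties may be broken in any (measurable, history-dependent) way.\<close>

definition is_R_ed_UCB :: "nat \<Rightarrow> real \<Rightarrow> real \<Rightarrow> real \<Rightarrow> nat \<Rightarrow> policy \<Rightarrow> bool" where
  "is_R_ed_UCB K \<sigma> \<epsilon> \<alpha> T \<pi> \<longleftrightarrow> is_policy K \<pi> \<and>
     (\<forall>t\<in>{1..T}. \<forall>h\<in>space (history_space K (t - 1)).
        is_arg_max (\<lambda>i. red_index \<sigma> \<epsilon> \<alpha> i t h) (\<lambda>i. i \<in> {1..K}) (\<pi> (t - 1) h))"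

end

theory Submission
  imports Defs "HOL-Real_Asymp.Real_Asymp"
begin

text \<open>
  The oracle plays the arm with the largest prefix sum, because prefix averages of a rising arm
  increase. On rounds where every window estimator is within its bonus, concavity makes the index
  optimistic, so the regret of the round is at most twice the bonus plus \<open>T * \<gamma>\<^sub>i (n - 2 * h + 1)\<close>
  for the chosen arm \<open>i\<close> after \<open>n\<close> pulls. Capping both by 1, the bonuses sum to
  \<open>X = (\<sigma> * T) powr (2/3) * (\<alpha> * ln T) powr (1/3) / \<epsilon>\<close> per arm (up to a constant), and the increments,
  read at the compressed times \<open>(1 - 2 * \<epsilon>) * n\<close>, are largest when the pulls are split evenly.

  Concentration is handled pathwise: a deviation in round \<open>t\<close>, for an arm with \<open>n\<close> pulls, forces
  \<open>t powr - \<alpha>\<close> times an exponential supermartingale with weights fixed by \<open>(t, i, n)\<close> to be at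
  least 1, so the indicator of failure is bounded by a sum of nonnegative functions with small mean.
\<close>

section \<open>Pull counts\<close>

text \<open>The obstacle is that the pull counts, hence the windows, are random and depend on
  earlier rewards, so the estimator at round \<open>t\<close> is not a fixed sum of independent
  terms. The reward law depends only on arm and pull number, both known before the reward is drawn,
  so weights that are a fixed function of round, arm and pull number are predictable. The price of
  guessing the count \<open>n\<close> is a union over \<open>n < t\<close>, two signs and
  \<open>K\<close> arms: mean at most 2 K t^(1 - \<alpha>) <= 2 K / t in round \<open>t\<close>.
  Failures thus cost a harmonic sum, which the leading term absorbs for large \<open>T\<close>.

  The 10 under the root of the bonus is 2 * 5: in units of \<sigma>^2 the estimator has variance
  proxy at most 5 D^2 / w^3 with D = t - n + w - 1, and a subgaussian deviation at level \<delta> is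
  sqrt (2 * proxy * ln (1 / \<delta>)). After \<open>n\<close> pulls the bonus is of order (X /
  n)^(3/2), so \<open>X\<close> is the count at which the cap by 1 and the summable tail
  balance.\<close>

lemma pulls_0 [simp]: "pulls h i 0 = 0"
  by (simp add: pulls_def)

lemma pulls_Suc: "pulls h i (Suc n) = pulls h i n + of_bool (arm_at h (Suc n) = i)"
proof -
  have "{l\<in>{1..Suc n}. arm_at h l = i} =
      (if arm_at h (Suc n) = i then insert (Suc n) else id) {l\<in>{1..n}. arm_at h l = i}"
    by (auto simp: le_Suc_eq)
  then show ?thesis
    by (auto simp: pulls_def card_insert_if)
qed

lemma pulls_mono: "m \<le> n \<Longrightarrow> pulls h i m \<le> pulls h i n"
  by (rule lift_Suc_mono_le) (auto simp: pulls_Suc)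

lemma pulls_le: "pulls h i n \<le> n"
  by (induction n) (auto simp: pulls_Suc)

lemma pulls_cong: "(\<And>s. s < n \<Longrightarrow> h s = h' s) \<Longrightarrow> pulls h i n = pulls h' i n"
  by (induction n) (simp_all add: pulls_Suc arm_at_def)

lemma pulls_pred:
  assumes "1 \<le> t"
  shows "pulls h (arm_at h t) t = Suc (pulls h (arm_at h t) (t - 1))"
  using assms by (cases t) (auto simp: pulls_Suc)

text \<open>Any earlier round has a strictly smaller count, because round \<open>Suc n\<close>
  itself adds one. Thus \<open>pull_round\<close> inverts the pull count on the rounds of arm
  \<open>i\<close>.\<close>

lemma pull_round_pulls:
  assumes "arm_at h (Suc n) = i"
  shows "pull_round h i (pulls h i (Suc n)) = Suc n"
  unfolding pull_round_def
proof (rule Least_equality)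
  fix t assume t: "1 \<le> t \<and> arm_at h t = i \<and> pulls h i t = pulls h i (Suc n)"
  show "Suc n \<le> t"
  proof (rule ccontr)
    assume "\<not> Suc n \<le> t"
    then have "pulls h i t \<le> pulls h i n"
      by (intro pulls_mono) auto
    with t assms show False by (simp add: pulls_Suc)
  qed
qed (use assms in auto)

text \<open>Both sides gain the same term exactly when a round pulls \<open>i\<close>. The summand
  sees round and pull number together because rewards are stored by round while means are indexed by
  pull.\<close>

lemma sum_rounds_of_arm:
  fixes f :: "nat \<Rightarrow> nat \<Rightarrow> 'a::comm_monoid_add"
  shows "(\<Sum>t\<in>{1..n}. if arm_at h t = i then f t (pulls h i t) else 0) =
    (\<Sum>l\<in>{1..pulls h i n}. f (pull_round h i l) l)"
proof (induction n)
  case (Suc n)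
  then show ?case
    using pull_round_pulls[of h n i] by (simp add: pulls_Suc)
qed simp

lemma sum_rounds_by_arm:
  fixes f :: "nat \<Rightarrow> nat \<Rightarrow> 'a::comm_monoid_add"
  assumes "\<And>t. t \<in> {1..n} \<Longrightarrow> arm_at h t \<in> A" "finite A"
  shows "(\<Sum>t\<in>{1..n}. f (arm_at h t) (pulls h (arm_at h t) t)) =
    (\<Sum>i\<in>A. \<Sum>l\<in>{1..pulls h i n}. f i l)"
proof -
  have "(\<Sum>i\<in>A. \<Sum>l\<in>{1..pulls h i n}. f i l) =
      (\<Sum>i\<in>A. \<Sum>t\<in>{1..n}. if arm_at h t = i then f i (pulls h i t) else 0)"
    by (rule sum.cong[OF refl], rule sum_rounds_of_arm[where f = "\<lambda>_. f _", symmetric])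
  also have "\<dots> = (\<Sum>t\<in>{1..n}. \<Sum>i\<in>A. if arm_at h t = i then f i (pulls h i t) else 0)"
    by (rule sum.swap)
  also have "\<dots> = (\<Sum>t\<in>{1..n}. f (arm_at h t) (pulls h (arm_at h t) t))"
    using assms by (intro sum.cong) (auto simp: sum.delta')
  finally show ?thesis ..
qed

lemma sum_pulls:
  assumes "\<And>t. t \<in> {1..n} \<Longrightarrow> arm_at h t \<in> A" "finite A"
  shows "(\<Sum>i\<in>A. pulls h i n) = n"
  using sum_rounds_by_arm[OF assms, where f = "\<lambda>_ _. (1::nat)"] by simp

section \<open>The law of the interaction\<close>

lemma measurable_arm_at:
  assumes "t \<in> {1..n}"
  shows "(\<lambda>h. arm_at h t) \<in> history_space K n \<rightarrow>\<^sub>M count_space {1..K}"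
proof -
  have "(\<lambda>h. h (t - 1)) \<in> history_space K n \<rightarrow>\<^sub>M round_space K"
    unfolding history_space_def using assms by (intro measurable_component_singleton) auto
  then show ?thesis
    unfolding arm_at_def round_space_def by (rule measurable_compose) simp
qed

lemma arm_at_history_space:
  "h \<in> space (history_space K n) \<Longrightarrow> t \<in> {1..n} \<Longrightarrow> arm_at h t \<in> {1..K}"
  using measurable_space[OF measurable_arm_at] by fastforce

lemma measurable_reward_at:
  assumes "t \<in> {1..n}"
  shows "(\<lambda>h. reward_at h t) \<in> borel_measurable (history_space K n)"
proof -
  have "(\<lambda>h. h (t - 1)) \<in> history_space K n \<rightarrow>\<^sub>M round_space K"
    unfolding history_space_def using assms by (intro measurable_component_singleton) auto
  then show ?thesis
    unfolding reward_at_def round_space_def by (rule measurable_compose) simp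
qed

lemma measurable_restrict_history:
  assumes "m \<le> n"
  shows "(\<lambda>h. restrict h {0..<m}) \<in> history_space K n \<rightarrow>\<^sub>M history_space K m"
  unfolding history_space_def using assms by (intro measurable_restrict_subset) auto

text \<open>\<open>measurable_pulls\<close> concerns histories of length exactly \<open>m\<close>; a
  longer history is restricted first, which leaves the count unchanged.\<close>

lemma measurable_pulls_le:
  assumes "m \<le> n"
  shows "(\<lambda>h. pulls h i m) \<in> history_space K n \<rightarrow>\<^sub>M count_space UNIV"
proof -
  have "(\<lambda>h. pulls (restrict h {0..<m}) i m) \<in> history_space K n \<rightarrow>\<^sub>M count_space UNIV"
    by (rule measurable_compose[OF measurable_restrict_history[OF assms] measurable_pulls])
  moreover have "pulls (restrict h {0..<m}) i m = pulls h i m" for h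
    by (rule pulls_cong) simp
  ultimately show ?thesis by simp
qed

lemma measurable_arm_pulls:
  fixes f :: "nat \<Rightarrow> nat \<Rightarrow> real"
  assumes "t \<in> {1..n}"
  shows "(\<lambda>h. f (arm_at h t) (pulls h (arm_at h t) t)) \<in> borel_measurable (history_space K n)"
proof (rule measurable_compose_countable'[OF _ measurable_arm_at[OF assms]])
  fix i :: nat
  show "(\<lambda>h. f i (pulls h i t)) \<in> borel_measurable (history_space K n)"
    by (rule measurable_compose[OF measurable_pulls_le]) (use assms in auto)
qed simp

locale interaction =
  fixes K :: nat and \<nu> :: bandit and \<pi> :: policy
  assumes rested: "rested_bandit K \<nu>" and policy: "is_policy K \<pi>"
begin

sublocale Ionescu_Tulcea "round_kernel K \<nu> \<pi>" "\<lambda>_. round_space K"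
  by (rule Ionescu_Tulcea_round_kernel[OF rested policy])

abbreviation law :: "nat \<Rightarrow> history measure" where
  "law \<equiv> history_law K \<nu> \<pi>"

lemma reward_law:
  assumes "i \<in> {1..K}" "1 \<le> n"
  shows "prob_space (\<nu> i n)" "sets (\<nu> i n) = sets borel"
  using rested assms by (auto simp: rested_bandit_def)

lemma policy_arm: "h \<in> space (history_space K n) \<Longrightarrow> \<pi> n h \<in> {1..K}"
  using measurable_space[of "\<pi> n" "history_space K n" "count_space {1..K}" h] policy
  by (auto simp: is_policy_def)

lemma prob_space_law: "prob_space (law n)"
  unfolding history_law_def by (rule prob_space_C) simp

lemma sets_law [measurable_cong]: "sets (law n) = sets (history_space K n)"
  unfolding history_law_def history_space_def by (subst sets_C) auto

lemma space_law: "space (law n) = space (history_space K n)"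
  by (rule sets_eq_imp_space_eq[OF sets_law])

lemma law_Suc: "law (Suc n) = law n \<bind> eP n"
  by (simp add: history_law_def)

lemma measurable_round: "i \<in> {1..K} \<Longrightarrow> 1 \<le> m \<Longrightarrow> Pair i \<in> \<nu> i m \<rightarrow>\<^sub>M round_space K"
  unfolding round_space_def
  by (subst measurable_cong_sets[OF reward_law(2) refl]) auto

lemma measurable_fun_upd_history:
  assumes "h \<in> space (history_space K n)"
  shows "(\<lambda>x. h(n := x)) \<in> round_space K \<rightarrow>\<^sub>M history_space K (Suc n)"
  using assms unfolding history_space_def
  by (intro measurable_fun_upd[where J = "{0..<n}"]) auto

text \<open>Tower property: the reward of the last round is integrated first, given the history
  before it. The nonnegative integral serves failure indicators and the exponential process
  alike.\<close>

lemma nn_integral_law_Suc: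
  assumes f: "f \<in> borel_measurable (history_space K (Suc n))"
  shows "(\<integral>\<^sup>+h. f h \<partial>law (Suc n)) =
    (\<integral>\<^sup>+h. \<integral>\<^sup>+r. f (h(n := (\<pi> n h, r))) \<partial>\<nu> (\<pi> n h) (pulls h (\<pi> n h) n + 1) \<partial>law n)"
proof -
  have "(\<integral>\<^sup>+h. f h \<partial>law (Suc n)) = (\<integral>\<^sup>+h. \<integral>\<^sup>+h'. f h' \<partial>eP n h \<partial>law n)"
    unfolding law_Suc
    by (rule nn_integral_bind[where B = "history_space K (Suc n)"])
      (use f in \<open>auto simp: history_space_def measurable_cong_sets[OF sets_law refl]\<close>)
  also have "\<dots> = (\<integral>\<^sup>+h. \<integral>\<^sup>+r. f (h(n := (\<pi> n h, r))) \<partial>\<nu> (\<pi> n h) (pulls h (\<pi> n h) n + 1) \<partial>law n)"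
  proof (rule nn_integral_cong)
    fix h assume "h \<in> space (law n)"
    then have h: "h \<in> space (history_space K n)" by (simp add: space_law)
    note arm = policy_arm[OF h]
    have "(\<integral>\<^sup>+h'. f h' \<partial>eP n h) = (\<integral>\<^sup>+x. f (h(n := x)) \<partial>round_kernel K \<nu> \<pi> n h)"
      using h f unfolding history_space_def by (rule nn_integral_eP)
    also have "\<dots> = (\<integral>\<^sup>+r. f (h(n := (\<pi> n h, r))) \<partial>\<nu> (\<pi> n h) (pulls h (\<pi> n h) n + 1))"
      unfolding round_kernel_def Let_def
      by (rule nn_integral_distr)
        (use arm h f in \<open>auto intro: measurable_round measurable_compose[OF measurable_fun_upd_history]\<close>)
    finally show "(\<integral>\<^sup>+h'. f h' \<partial>eP n h) = \<dots>" .
  qed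
  finally show ?thesis .
qed

text \<open>Demanding \<open>P\<close> for every reward \<open>r\<close> makes the inner integral of
  the failure indicator vanish for almost every \<open>h\<close>.\<close>

lemma AE_law_SucI:
  assumes P: "Measurable.pred (history_space K (Suc n)) P"
    and step: "AE h in law n. \<forall>r. P (h(n := (\<pi> n h, r)))"
  shows "AE h in law (Suc n). P h"
proof -
  have "{h \<in> space (history_space K (Suc n)). \<not> P h} \<in> sets (history_space K (Suc n))"
    using P by measurable
  then have m: "(\<lambda>h. indicator {h \<in> space (history_space K (Suc n)). \<not> P h} h :: ennreal)
      \<in> borel_measurable (history_space K (Suc n))"
    by simp
  have "(\<integral>\<^sup>+h. indicator {h \<in> space (history_space K (Suc n)). \<not> P h} h \<partial>law (Suc n)) = (\<integral>\<^sup>+h. 0 \<partial>law n)"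
    unfolding nn_integral_law_Suc[OF m]
    by (rule nn_integral_cong_AE, rule AE_mp[OF step], rule AE_I2)
      (auto simp: indicator_def)
  then have "emeasure (law (Suc n)) {h \<in> space (law (Suc n)). \<not> P h} = 0"
    using \<open>_ \<in> sets (history_space K (Suc n))\<close> by (simp add: sets_law space_law)
  then show ?thesis
    using P by (subst AE_iff_measurable[OF _ refl]) (auto simp: sets_law space_law)
qed

text \<open>The history space also contains paths that the policy never generates. This links
  \<open>arm_at\<close>, in which the regret is written, to \<pi>, to which the argmax property of
  the algorithm applies.\<close>

lemma AE_law_follows_policy:
  "AE h in law n. \<forall>t\<in>{1..n}. arm_at h t = \<pi> (t - 1) (restrict h {0..<t - 1})"
proof (induction n)
  case (Suc n)
  have eq: "Measurable.pred (history_space K (Suc n))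
      (\<lambda>h. arm_at h t = \<pi> (t - 1) (restrict h {0..<t - 1}))" if "t \<in> {1..Suc n}" for t
  proof -
    have a: "(\<lambda>h. arm_at h t) \<in> history_space K (Suc n) \<rightarrow>\<^sub>M count_space UNIV"
      by (rule measurable_compose[OF measurable_arm_at[OF that]]) simp
    have "\<pi> (t - 1) \<in> history_space K (t - 1) \<rightarrow>\<^sub>M count_space {1..K}"
      using policy by (auto simp: is_policy_def)
    then have "(\<lambda>h. \<pi> (t - 1) (restrict h {0..<t - 1})) \<in> history_space K (Suc n) \<rightarrow>\<^sub>M count_space {1..K}"
      by (rule measurable_compose[OF measurable_restrict_history, rotated]) (use that in auto)
    then have "(\<lambda>h. \<pi> (t - 1) (restrict h {0..<t - 1})) \<in> history_space K (Suc n) \<rightarrow>\<^sub>M count_space UNIV"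
      by (rule measurable_compose) simp
    with a show ?thesis by measurable
  qed
  show ?case
  proof (rule AE_law_SucI)
    show "Measurable.pred (history_space K (Suc n))
        (\<lambda>h. \<forall>t\<in>{1..Suc n}. arm_at h t = \<pi> (t - 1) (restrict h {0..<t - 1}))"
      by (intro pred_intros_finite eq) auto
    show "AE h in law n. \<forall>r. \<forall>t\<in>{1..Suc n}.
        arm_at (h(n := (\<pi> n h, r))) t = \<pi> (t - 1) (restrict (h(n := (\<pi> n h, r))) {0..<t - 1})"
    proof (rule AE_mp[OF Suc.IH], rule AE_I2, intro impI allI ballI)
      fix h r t
      assume h: "h \<in> space (law n)"
        and IH: "\<forall>t\<in>{1..n}. arm_at h t = \<pi> (t - 1) (restrict h {0..<t - 1})"
        and t: "t \<in> {1..Suc n}"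
      have restr: "restrict (h(n := x)) {0..<t - 1} = restrict h {0..<t - 1}" for x
        using t by (auto simp: restrict_def fun_eq_iff)
      show "arm_at (h(n := (\<pi> n h, r))) t = \<pi> (t - 1) (restrict (h(n := (\<pi> n h, r))) {0..<t - 1})"
      proof (cases "t = Suc n")
        case True
        \<comment> \<open>Histories are extensional, so restricting one of length \<open>n\<close>
          to its own index set returns it; the kernel applies \<open>\<pi> n\<close> to
          \<open>h\<close> itself.\<close>
        have "restrict h {0..<n} = h"
          using h by (auto simp: space_law history_space_def space_PiM intro: PiE_restrict)
        with True show ?thesis
          unfolding restr by (simp add: arm_at_def)
      next
        case False
        with t IH have "arm_at h t = \<pi> (t - 1) (restrict h {0..<t - 1})"
          by auto
        moreover have "t - 1 \<noteq> n" using t False by auto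
        ultimately show ?thesis unfolding restr by (simp add: arm_at_def)
      qed
    qed
  qed
qed simp

end

section \<open>Exponential supermartingales with predictable weights\<close>

text \<open>Exponential of the weighted centred rewards minus their subgaussian compensator. The
  weight is read at the arm and count of the round, which are known before its reward; a zero weight
  switches the round off.\<close>

definition exp_process :: "bandit \<Rightarrow> real \<Rightarrow> (nat \<Rightarrow> nat \<Rightarrow> nat \<Rightarrow> real) \<Rightarrow> nat \<Rightarrow> history \<Rightarrow> real" where
  "exp_process \<nu> \<sigma> a n h = exp (\<Sum>t\<in>{1..n}.
     (let i = arm_at h t; m = pulls h i t
      in a t i m * (reward_at h t - mean_reward \<nu> i m) - \<sigma>\<^sup>2 * (a t i m)\<^sup>2 / 2))"

lemma measurable_exp_process:
  "exp_process \<nu> \<sigma> a n \<in> borel_measurable (history_space K n)"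
  unfolding exp_process_def Let_def
  by (intro borel_measurable_exp borel_measurable_sum borel_measurable_diff borel_measurable_times
      measurable_arm_pulls[where f = "\<lambda>i m. a _ i m"] measurable_arm_pulls[where f = "mean_reward \<nu>"]
      measurable_arm_pulls[where f = "\<lambda>i m. \<sigma>\<^sup>2 * (a _ i m)\<^sup>2 / 2"] measurable_reward_at
      measurable_compose[OF _ borel_measurable_exp]) auto

text \<open>Given the past, one more round multiplies the process by a factor of mean at most 1: the
  weight is constant in the reward, and the compensator cancels the moment bound.\<close>

lemma (in interaction) nn_integral_exp_process_le_1:
  assumes sub: "subgaussian_rewards K \<nu> \<sigma>"
  shows "(\<integral>\<^sup>+h. ennreal (exp_process \<nu> \<sigma> a n h) \<partial>law n) \<le> 1"
proof (induction n)
  case 0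
  then show ?case
    using prob_space.emeasure_space_1[OF prob_space_law[of 0]]
    by (simp add: exp_process_def)
next
  case (Suc n)
  have m: "(\<lambda>h. ennreal (exp_process \<nu> \<sigma> a (Suc n) h)) \<in> borel_measurable (history_space K (Suc n))"
    using measurable_exp_process by measurable
  have "(\<integral>\<^sup>+h. ennreal (exp_process \<nu> \<sigma> a (Suc n) h) \<partial>law (Suc n)) \<le>
      (\<integral>\<^sup>+h. ennreal (exp_process \<nu> \<sigma> a n h) \<partial>law n)"
    unfolding nn_integral_law_Suc[OF m]
  proof (rule nn_integral_mono)
    fix h assume "h \<in> space (law n)"
    then have h: "h \<in> space (history_space K n)" by (simp add: space_law)
    define i where "i = \<pi> n h"
    define k where "k = pulls h i n + 1"
    define x where "x = a (Suc n) i k"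
    have i: "i \<in> {1..K}" and k: "1 \<le> k"
      using policy_arm[OF h] by (auto simp: i_def k_def)
    have step: "exp_process \<nu> \<sigma> a (Suc n) (h(n := (i, r))) =
        exp_process \<nu> \<sigma> a n h * exp (- \<sigma>\<^sup>2 * x\<^sup>2 / 2) * exp (x * (r - mean_reward \<nu> i k))" for r
    proof -
      have p: "pulls (h(n := (i, r))) j t = pulls h j t" if "t \<le> n" for j t
        using that by (intro pulls_cong) auto
      have "exp_process \<nu> \<sigma> a n (h(n := (i, r))) = exp_process \<nu> \<sigma> a n h"
        unfolding exp_process_def Let_def
        by (intro arg_cong[of _ _ exp] sum.cong) (auto simp: arm_at_def reward_at_def p)
      moreover have "pulls (h(n := (i, r))) i (Suc n) = k"
        by (simp add: pulls_Suc p k_def arm_at_def)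
      ultimately show ?thesis
        unfolding exp_process_def
        by (simp add: arm_at_def reward_at_def x_def exp_add[symmetric] Let_def)
    qed
    have mgf: "integrable (\<nu> i k) (\<lambda>r. exp (x * (r - mean_reward \<nu> i k)))"
      "(\<integral>r. exp (x * (r - mean_reward \<nu> i k)) \<partial>\<nu> i k) \<le> exp (\<sigma>\<^sup>2 * x\<^sup>2 / 2)"
      using sub i k by (auto simp: subgaussian_rewards_def)
    let ?c = "exp_process \<nu> \<sigma> a n h * exp (- \<sigma>\<^sup>2 * x\<^sup>2 / 2)"
    have c: "0 \<le> ?c" by (simp add: exp_process_def)
    have "(\<integral>\<^sup>+r. ennreal (exp_process \<nu> \<sigma> a (Suc n) (h(n := (i, r)))) \<partial>\<nu> i k) =
        ennreal (\<integral>r. ?c * exp (x * (r - mean_reward \<nu> i k)) \<partial>\<nu> i k)"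
      unfolding step using mgf(1) c by (intro nn_integral_eq_integral) auto
    also have "\<dots> \<le> ennreal (?c * exp (\<sigma>\<^sup>2 * x\<^sup>2 / 2))"
      using mgf c by (intro ennreal_leI) (auto intro: mult_left_mono)
    also have "\<dots> = ennreal (exp_process \<nu> \<sigma> a n h)"
      by (simp add: mult.assoc exp_add[symmetric])
    finally show "(\<integral>\<^sup>+r. ennreal (exp_process \<nu> \<sigma> a (Suc n) (h(n := (\<pi> n h, r))))
        \<partial>\<nu> (\<pi> n h) (pulls h (\<pi> n h) n + 1)) \<le> ennreal (exp_process \<nu> \<sigma> a n h)"
      by (simp add: i_def k_def)
  qed
  with Suc.IH show ?case by (rule order_trans[rotated])
qed

section \<open>Concentration of the window estimator\<close>

text \<open>Coefficient of the reward of pull \<open>l\<close> in the estimator. The recent half of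
  the \<open>2 * w\<close> pulls carries the level and the extrapolation; a pull of the older half
  occurs only as the subtracted reward of pull \<open>l + w\<close>, hence the factor
  \<open>t - l - w\<close>.\<close>

definition red_coeff :: "nat \<Rightarrow> nat \<Rightarrow> nat \<Rightarrow> nat \<Rightarrow> real" where
  "red_coeff t n w l =
     (if n - w < l then (1 + (real t - real l) / real w) / real w
      else if n - 2 * w < l then - (real t - real l - real w) / (real w)\<^sup>2
      else 0)"

lemma sum_red_coeff_split:
  fixes f :: "nat \<Rightarrow> real"
  assumes "1 \<le> w" "2 * w \<le> n" and f: "\<And>l. l \<le> n - 2 * w \<Longrightarrow> f l = 0"
  shows "(\<Sum>l\<in>{1..n}. f l) = (\<Sum>l\<in>{n - 2 * w + 1..n - w}. f l) + (\<Sum>l\<in>{n - w + 1..n}. f l)"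
proof -
  have "{1..n} = {1..n - 2 * w} \<union> {n - 2 * w + 1..n}" using assms by auto
  then have "(\<Sum>l\<in>{1..n}. f l) = (\<Sum>l\<in>{1..n - 2 * w}. f l) + (\<Sum>l\<in>{n - 2 * w + 1..n}. f l)"
    by (simp only:) (rule sum.union_disjoint; auto)
  also have "(\<Sum>l\<in>{1..n - 2 * w}. f l) = 0" using f by simp
  also have "{n - 2 * w + 1..n} = {n - 2 * w + 1..n - w} \<union> {n - w + 1..n}" using assms by auto
  also have "(\<Sum>l\<in>\<dots>. f l) = (\<Sum>l\<in>{n - 2 * w + 1..n - w}. f l) + (\<Sum>l\<in>{n - w + 1..n}. f l)"
    by (rule sum.union_disjoint) auto
  finally show ?thesis by simp
qed

lemma window_sum_eq_red_coeff:
  fixes x :: "nat \<Rightarrow> real"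
  assumes w: "1 \<le> w" "2 * w \<le> n"
  shows "1 / real w * (\<Sum>l\<in>{n - w + 1..n}. x l + (real t - real l) * ((x l - x (l - w)) / real w)) =
    (\<Sum>l\<in>{1..n}. red_coeff t n w l * x l)"
proof -
  have "1 / real w * (\<Sum>l\<in>{n - w + 1..n}. x l + (real t - real l) * ((x l - x (l - w)) / real w)) =
      (\<Sum>l\<in>{n - w + 1..n}. (1 + (real t - real l) / real w) / real w * x l
         - (real t - real l) / (real w)\<^sup>2 * x (l - w))"
    unfolding sum_distrib_left using w
    by (intro sum.cong refl) (simp add: field_simps power2_eq_square)
  also have "\<dots> = (\<Sum>l\<in>{n - w + 1..n}. (1 + (real t - real l) / real w) / real w * x l)
      - (\<Sum>l\<in>{n - w + 1..n}. (real t - real l) / (real w)\<^sup>2 * x (l - w))"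
    by (rule sum_subtractf)
  also have "{n - w + 1..n} = {(n - 2 * w + 1) + w..(n - w) + w}" using w by auto
  also have "(\<Sum>l\<in>\<dots>. (real t - real l) / (real w)\<^sup>2 * x (l - w)) =
      (\<Sum>l\<in>{n - 2 * w + 1..n - w}. (real t - real l - real w) / (real w)\<^sup>2 * x l)"
    unfolding sum.shift_bounds_cl_nat_ivl by (simp add: algebra_simps)
  also have "{(n - 2 * w + 1) + w..(n - w) + w} = {n - w + 1..n}" using w by auto
  also have "(\<Sum>l\<in>{n - w + 1..n}. (1 + (real t - real l) / real w) / real w * x l) =
      (\<Sum>l\<in>{n - w + 1..n}. red_coeff t n w l * x l)"
    by (intro sum.cong) (auto simp: red_coeff_def)
  also have "(\<Sum>l\<in>{n - 2 * w + 1..n - w}. (real t - real l - real w) / (real w)\<^sup>2 * x l) =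
      - (\<Sum>l\<in>{n - 2 * w + 1..n - w}. red_coeff t n w l * x l)"
    unfolding sum_negf[symmetric]
    by (intro sum.cong) (auto simp: red_coeff_def field_simps)
  finally show ?thesis
    using sum_red_coeff_split[OF w, of "\<lambda>l. red_coeff t n w l * x l"] w by (simp add: red_coeff_def)
qed

text \<open>With D = t - n + w - 1, the older coefficients are at most D / w^2 in absolute value,
  the recent ones at most (D + w) / w^2 <= 2 D / w^2. Each half has \<open>w\<close> of them, so 5 =
  1 + 4.\<close>

lemma sum_red_coeff_squares_le:
  assumes w: "1 \<le> w" "2 * w \<le> n" and t: "n < t"
  shows "(\<Sum>l\<in>{1..n}. (red_coeff t n w l)\<^sup>2) \<le> 5 * (real t - real n + real w - 1)\<^sup>2 / real w ^ 3"
proof -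
  define D where "D = real t - real n + real w - 1"
  have D: "real w \<le> D" using t by (simp add: D_def)
  have "(red_coeff t n w l)\<^sup>2 \<le> (D / (real w)\<^sup>2)\<^sup>2" if "l \<in> {n - 2 * w + 1..n - w}" for l
  proof -
    have "real l + real w \<le> n" "real n - 2 * real w + 1 \<le> real l"
      using that w by auto
    then have "\<bar>real t - real l - real w\<bar> \<le> \<bar>D\<bar>" using t unfolding D_def by auto
    then have "\<bar>(real t - real l - real w) / (real w)\<^sup>2\<bar> \<le> \<bar>D / (real w)\<^sup>2\<bar>"
      by (simp add: divide_right_mono)
    moreover have "red_coeff t n w l = - ((real t - real l - real w) / (real w)\<^sup>2)"
      using that w unfolding red_coeff_def by (simp only: minus_divide_left) auto
    ultimately show ?thesis
      by (simp only: abs_le_square_iff power2_minus)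
  qed
  then have "(\<Sum>l\<in>{n - 2 * w + 1..n - w}. (red_coeff t n w l)\<^sup>2) \<le>
      of_nat (card {n - 2 * w + 1..n - w}) * (D / (real w)\<^sup>2)\<^sup>2"
    by (rule sum_bounded_above)
  also have "card {n - 2 * w + 1..n - w} = w" using w by simp
  finally have mid: "(\<Sum>l\<in>{n - 2 * w + 1..n - w}. (red_coeff t n w l)\<^sup>2) \<le> w * (D / (real w)\<^sup>2)\<^sup>2" .
  have "(red_coeff t n w l)\<^sup>2 \<le> (2 * D / (real w)\<^sup>2)\<^sup>2" if "l \<in> {n - w + 1..n}" for l
  proof -
    have l: "real l \<le> n" "real n - real w + 1 \<le> real l"
      using that w by auto
    have "(1 + (real t - real l) / real w) / real w = (real w + (real t - real l)) / (real w)\<^sup>2"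
      using w by (simp add: field_simps power2_eq_square)
    then have "red_coeff t n w l = (real w + (real t - real l)) / (real w)\<^sup>2"
      using that w by (auto simp: red_coeff_def)
    moreover have "0 \<le> real w + (real t - real l)" "real w + (real t - real l) \<le> 2 * D"
      using l t D unfolding D_def by auto
    ultimately show ?thesis by (auto intro!: power_mono divide_right_mono)
  qed
  then have "(\<Sum>l\<in>{n - w + 1..n}. (red_coeff t n w l)\<^sup>2) \<le>
      of_nat (card {n - w + 1..n}) * (2 * D / (real w)\<^sup>2)\<^sup>2"
    by (rule sum_bounded_above)
  also have "card {n - w + 1..n} = w" using w by simp
  finally have "(\<Sum>l\<in>{n - w + 1..n}. (red_coeff t n w l)\<^sup>2) \<le> w * (2 * D / (real w)\<^sup>2)\<^sup>2" .
  with mid have "(\<Sum>l\<in>{1..n}. (red_coeff t n w l)\<^sup>2) \<le> w * (D / (real w)\<^sup>2)\<^sup>2 + w * (2 * D / (real w)\<^sup>2)\<^sup>2"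
    using sum_red_coeff_split[OF w, of "\<lambda>l. (red_coeff t n w l)\<^sup>2"] w by (simp add: red_coeff_def)
  also have "\<dots> = 5 * D\<^sup>2 / real w ^ 3"
    using w by (simp add: field_simps power2_eq_square power3_eq_cube)
  finally show ?thesis by (simp add: D_def)
qed

text \<open>Weights confined to arm \<open>i\<close> and the first \<open>m\<close> rounds turn the
  process at time \<open>T\<close> into a statistic of what was seen of arm \<open>i\<close> by
  round \<open>m\<close>. All rounds are thereby handled under the single law of \<open>T\<close>
  rounds.\<close>

lemma exp_process_single_arm:
  assumes "m \<le> T"
  shows "exp_process \<nu> \<sigma> (\<lambda>u j l. if u \<le> m \<and> j = i then b l else 0) T h =
    exp (\<Sum>l\<in>{1..pulls h i m}.
      b l * (reward_at h (pull_round h i l) - mean_reward \<nu> i l) - \<sigma>\<^sup>2 * (b l)\<^sup>2 / 2)"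
proof -
  let ?f = "\<lambda>u l. b l * (reward_at h u - mean_reward \<nu> i l) - \<sigma>\<^sup>2 * (b l)\<^sup>2 / 2"
  have "(\<Sum>u\<in>{1..T}. let j = arm_at h u; l = pulls h j u; c = if u \<le> m \<and> j = i then b l else 0
      in c * (reward_at h u - mean_reward \<nu> j l) - \<sigma>\<^sup>2 * c\<^sup>2 / 2) =
      (\<Sum>u\<in>{1..m}. if arm_at h u = i then ?f u (pulls h i u) else 0)"
    using assms by (intro sum.mono_neutral_cong_right) (auto simp: Let_def)
  also have "\<dots> = (\<Sum>l\<in>{1..pulls h i m}. ?f (pull_round h i l) l)"
    by (rule sum_rounds_of_arm)
  finally show ?thesis
    by (simp add: exp_process_def Let_def)
qed

text \<open>
  The exponential tilt is the Chernoff-optimal one for the deviation \<open>D * sqrt (10 * a / w ^ 3)\<close>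
  (in units of \<open>\<sigma>\<close>) of a linear statistic with variance proxy \<open>5 * D\<^sup>2 / w ^ 3\<close>.
\<close>

lemma chernoff_exponent:
  fixes y S D \<sigma> a :: real and w :: nat
  assumes "1 \<le> w" "0 < D" "0 < \<sigma>" "0 \<le> a"
    and S: "S \<le> 5 * D\<^sup>2 / real w ^ 3"
    and y: "\<sigma> * D * sqrt (10 * a / real w ^ 3) \<le> y"
  defines "x \<equiv> sqrt (10 * a / real w ^ 3) / (\<sigma> * D) * real w ^ 3 / 5"
  shows "a \<le> x * y - \<sigma>\<^sup>2 * x\<^sup>2 * S / 2"
proof -
  define s where "s = sqrt (10 * a / real w ^ 3)"
  have s: "0 \<le> s" and s2: "s\<^sup>2 = 10 * a / real w ^ 3"
    using assms by (auto simp: s_def)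
  have x: "x = s / (\<sigma> * D) * real w ^ 3 / 5" by (simp add: x_def s_def)
  have x0: "0 \<le> x" unfolding x using s assms by auto
  have "\<sigma>\<^sup>2 * x\<^sup>2 * S / 2 \<le> \<sigma>\<^sup>2 * x\<^sup>2 * (5 * D\<^sup>2 / real w ^ 3) / 2"
    using S by (intro divide_right_mono mult_left_mono) auto
  also have "\<dots> = s\<^sup>2 * real w ^ 3 / 10"
    unfolding x using assms by (simp add: field_simps power2_eq_square power3_eq_cube)
  also have "\<dots> = a" unfolding s2 using assms by simp
  finally have 1: "\<sigma>\<^sup>2 * x\<^sup>2 * S / 2 \<le> a" .
  have "2 * a = s\<^sup>2 * real w ^ 3 / 5" unfolding s2 using assms by simp
  also have "\<dots> = x * (\<sigma> * D * s)"
    unfolding x using assms by (simp add: field_simps power2_eq_square power3_eq_cube)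
  also have "\<dots> \<le> x * y" using y x0 by (intro mult_left_mono) (auto simp: s_def)
  finally show ?thesis using 1 by simp
qed

text \<open>\<open>n\<close> is a guess for the pull count of arm \<open>i\<close> before round
  \<open>t\<close>, which makes the window and the tilt \<open>x\<close> deterministic.
  \<open>s\<close> is the side of the deviation and \<open>a\<close> the logarithm of the inverse
  failure level.\<close>

definition deviation_weight ::
  "bandit \<Rightarrow> real \<Rightarrow> real \<Rightarrow> real \<Rightarrow> nat \<Rightarrow> nat \<Rightarrow> nat \<Rightarrow> nat \<Rightarrow> real \<Rightarrow> history \<Rightarrow> real" where
  "deviation_weight \<nu> \<sigma> \<epsilon> a T t i n s =
     (let w = nat \<lfloor>\<epsilon> * real n\<rfloor>; D = real t - real n + real w - 1;
          x = sqrt (10 * a / real w ^ 3) / (\<sigma> * D) * real w ^ 3 / 5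
      in exp_process \<nu> \<sigma> (\<lambda>u j l. if u \<le> t - 1 \<and> j = i then s * x * red_coeff t n w l else 0) T)"

lemma measurable_deviation_weight:
  "deviation_weight \<nu> \<sigma> \<epsilon> a T t i n s \<in> borel_measurable (history_space K T)"
  unfolding deviation_weight_def Let_def by (rule measurable_exp_process)

lemma deviation_weight_nonneg: "0 \<le> deviation_weight \<nu> \<sigma> \<epsilon> a T t i n s h"
  by (simp add: deviation_weight_def exp_process_def Let_def)

text \<open>When the guess \<open>n\<close> is the true count, the exponent is the Chernoff exponent
  of \<open>s\<close> times the deviation; \<open>s\<^sup>2 = 1\<close> removes the sign from the
  quadratic part.\<close>

lemma deviation_weight_ge:
  fixes h :: history
  defines "X \<equiv> \<lambda>i l. reward_at h (pull_round h i l)"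
  assumes t: "t \<in> {1..T}" and n: "n = pulls h i (t - 1)" and w: "w = nat \<lfloor>\<epsilon> * real n\<rfloor>"
    and w1: "1 \<le> w" "2 * w \<le> n" and "0 < \<sigma>" "0 \<le> a" and s: "s\<^sup>2 = 1"
    and dev: "\<sigma> * (real t - real n + real w - 1) * sqrt (10 * a / real w ^ 3) \<le>
      s * (\<Sum>l\<in>{1..n}. red_coeff t n w l * (X i l - mean_reward \<nu> i l))"
  shows "exp a \<le> deviation_weight \<nu> \<sigma> \<epsilon> a T t i n s h"
proof -
  define D where "D = real t - real n + real w - 1"
  define x where "x = sqrt (10 * a / real w ^ 3) / (\<sigma> * D) * real w ^ 3 / 5"
  have tT: "t - 1 \<le> T" using t by auto
  have nt: "n < t" using pulls_le[of h i "t - 1"] t n by auto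
  then have D: "0 < D" using w1 by (auto simp: D_def)
  have "deviation_weight \<nu> \<sigma> \<epsilon> a T t i n s h =
      exp (\<Sum>l\<in>{1..n}. s * x * red_coeff t n w l * (X i l - mean_reward \<nu> i l)
        - \<sigma>\<^sup>2 * (s * x * red_coeff t n w l)\<^sup>2 / 2)"
    unfolding deviation_weight_def Let_def exp_process_single_arm[OF tT]
    by (simp only: n[symmetric] w[symmetric] x_def D_def X_def)
  also have "(\<Sum>l\<in>{1..n}. s * x * red_coeff t n w l * (X i l - mean_reward \<nu> i l)
        - \<sigma>\<^sup>2 * (s * x * red_coeff t n w l)\<^sup>2 / 2) =
      x * (s * (\<Sum>l\<in>{1..n}. red_coeff t n w l * (X i l - mean_reward \<nu> i l)))
      - \<sigma>\<^sup>2 * x\<^sup>2 * (\<Sum>l\<in>{1..n}. (red_coeff t n w l)\<^sup>2) / 2"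
    by (simp add: sum_subtractf sum.distrib sum_distrib_left sum_divide_distrib power_mult_distrib s algebra_simps)
  finally show ?thesis
    using chernoff_exponent[OF w1(1) D \<open>0 < \<sigma>\<close> \<open>0 \<le> a\<close> sum_red_coeff_squares_le[OF w1 nt, folded D_def] dev[folded D_def]]
    by (simp add: x_def)
qed

lemma (in interaction) nn_integral_deviation_weight_le_1:
  assumes "subgaussian_rewards K \<nu> \<sigma>"
  shows "(\<integral>\<^sup>+h. ennreal (deviation_weight \<nu> \<sigma> \<epsilon> a T t i n s h) \<partial>law T) \<le> 1"
  unfolding deviation_weight_def Let_def using assms by (rule nn_integral_exp_process_le_1)

section \<open>The index as a function of the past\<close>

text \<open>If the \<open>l\<close>-th pull is not among the first \<open>m\<close> rounds, it is
  round \<open>Suc m\<close>, and \<open>pull_round_pulls\<close> locates it in both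
  histories.\<close>

lemma pull_round_cong:
  assumes "l \<in> {1..pulls h i m}" and eq: "\<And>s. s < m \<Longrightarrow> h s = h' s"
  shows "pull_round h' i l = pull_round h i l \<and> pull_round h i l \<in> {1..m}"
  using assms
proof (induction m)
  case (Suc m)
  show ?case
  proof (cases "l \<le> pulls h i m")
    case True
    with Suc show ?thesis by fastforce
  next
    case False
    with Suc.prems have arm: "arm_at h (Suc m) = i" and l: "l = pulls h i (Suc m)"
      by (cases "arm_at h (Suc m) = i"; simp add: pulls_Suc)+
    have "arm_at h' (Suc m) = i"
      using arm Suc.prems(2)[of m] by (simp add: arm_at_def)
    moreover have "l = pulls h' i (Suc m)"
      unfolding l by (rule pulls_cong) (use Suc.prems in auto)
    ultimately show ?thesis
      using pull_round_pulls[OF arm] pull_round_pulls[of h' m i] l by simp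
  qed
qed simp

lemma two_window_le: "0 \<le> \<epsilon> \<Longrightarrow> \<epsilon> < 1/2 \<Longrightarrow> 2 * nat \<lfloor>\<epsilon> * real n\<rfloor> \<le> n"
  using mult_right_mono[of \<epsilon> "1/2" "real n"] by linarith

text \<open>The policy sees the history cut at \<open>t - 1\<close>, the analysis the full one. As
  \<open>2 * w\<close> is at most the pull count, \<open>l - w\<close> stays at least 1, and every
  reward that is read lies before round \<open>t\<close>.\<close>

lemma red_index_cong:
  assumes eq: "\<And>s. s < t - 1 \<Longrightarrow> h s = h' s" and "0 \<le> \<epsilon>" "\<epsilon> < 1/2"
  shows "red_index \<sigma> \<epsilon> \<alpha> i t h' = red_index \<sigma> \<epsilon> \<alpha> i t h"
proof -
  have p: "pulls h' i (t - 1) = pulls h i (t - 1)"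
    by (rule pulls_cong[symmetric]) (rule eq)
  have X: "reward_at h' (pull_round h' i l) = reward_at h (pull_round h i l)"
    if "l \<in> {1..pulls h i (t - 1)}" for l
  proof -
    have "pull_round h' i l = pull_round h i l" "pull_round h i l \<in> {1..t - 1}"
      using pull_round_cong[OF that eq] by auto
    then show ?thesis using eq[of "pull_round h i l - 1"] by (auto simp: reward_at_def)
  qed
  define w where "w = red_window \<epsilon> i t h"
  have w: "2 * w \<le> pulls h i (t - 1)"
    unfolding w_def red_window_def using assms by (intro two_window_le) auto
  have "red_window \<epsilon> i t h' = w" by (simp only: w_def red_window_def p)
  moreover have "red_estimator w i t h' = red_estimator w i t h" if "w \<noteq> 0"
  proof -
    have "(\<Sum>l\<in>{N - w + 1..N}. reward_at h' (pull_round h' i l) + (real t - real l) *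
          ((reward_at h' (pull_round h' i l) - reward_at h' (pull_round h' i (l - w))) / real w)) =
        (\<Sum>l\<in>{N - w + 1..N}. reward_at h (pull_round h i l) + (real t - real l) *
          ((reward_at h (pull_round h i l) - reward_at h (pull_round h i (l - w))) / real w))"
      if "N = pulls h i (t - 1)" for N
    proof (rule sum.cong[OF refl])
      fix l assume "l \<in> {N - w + 1..N}"
      then have "l \<in> {1..pulls h i (t - 1)}" "l - w \<in> {1..pulls h i (t - 1)}"
        using w that by auto
      note X[OF this(1)] X[OF this(2)]
      then show "reward_at h' (pull_round h' i l) + (real t - real l) *
          ((reward_at h' (pull_round h' i l) - reward_at h' (pull_round h' i (l - w))) / real w) =
        reward_at h (pull_round h i l) + (real t - real l) *
          ((reward_at h (pull_round h i l) - reward_at h (pull_round h i (l - w))) / real w)"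
        by simp
    qed
    then show ?thesis unfolding red_estimator_def Let_def p by simp
  qed
  moreover have "red_estimator w i t h' = red_estimator w i t h" if "w = 0"
    using that by (simp add: red_estimator_def)
  moreover have "red_bonus \<sigma> w i t \<delta> h' = red_bonus \<sigma> w i t \<delta> h" for \<delta>
    by (simp only: red_bonus_def p)
  ultimately show ?thesis
    unfolding red_index_def Let_def w_def[symmetric] by (cases "w = 0") simp_all
qed

lemma red_index_eq:
  assumes n: "n = pulls h i (t - 1)" and w: "w = nat \<lfloor>\<epsilon> * real n\<rfloor>" and "1 \<le> w" "2 * w \<le> n" "1 \<le> t"
  shows "red_index \<sigma> \<epsilon> \<alpha> i t h =
    ereal ((\<Sum>l\<in>{1..n}. red_coeff t n w l * reward_at h (pull_round h i l)) +
      \<sigma> * (real t - real n + real w - 1) * sqrt (10 * (\<alpha> * ln (real t)) / real w ^ 3))"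
proof -
  have ln: "ln (1 / (real t powr - \<alpha>)) = \<alpha> * ln (real t)"
    using \<open>1 \<le> t\<close> by (simp add: powr_minus_divide ln_powr)
  have window: "red_window \<epsilon> i t h = w" by (simp add: red_window_def n w)
  have "w \<noteq> 0" using assms(3) by simp
  then show ?thesis
    unfolding red_index_def Let_def red_estimator_def red_bonus_def window n[symmetric] ln
      window_sum_eq_red_coeff[where x = "\<lambda>l. reward_at h (pull_round h i l)", OF assms(3,4)]
    by simp
qed

lemma red_index_infinite:
  "red_window \<epsilon> i t h = 0 \<Longrightarrow> red_index \<sigma> \<epsilon> \<alpha> i t h = \<infinity>"
  by (simp add: red_index_def Let_def red_estimator_def red_bonus_def)

section \<open>Concave arms and the regret of a round\<close>

locale rising_arm =
  fixes m :: "nat \<Rightarrow> real" and g :: "nat \<Rightarrow> real"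
  assumes g: "\<And>n. g n = m (n + 1) - m n"
    and g_nonneg: "\<And>n. 1 \<le> n \<Longrightarrow> 0 \<le> g n"
    and g_step: "\<And>n. 1 \<le> n \<Longrightarrow> g (n + 1) \<le> g n"
begin

lemma g_antimono:
  assumes "1 \<le> k" "k \<le> n"
  shows "g n \<le> g k"
  using assms(2)
proof (induction rule: dec_induct)
  case (step n)
  then show ?case using g_step[of n] assms(1) by simp
qed simp

lemma m_Suc: "m (Suc n) = m n + g n"
  using g[of n] by simp

lemma m_mono:
  assumes "1 \<le> k" "k \<le> n"
  shows "m k \<le> m n"
  using assms(2)
proof (induction rule: dec_induct)
  case (step n)
  then show ?case using g_nonneg[of n] assms(1) by (simp add: m_Suc)
qed simp

lemma m_diff_le:
  assumes "1 \<le> k" "k \<le> n"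
  shows "m n - m k \<le> (real n - real k) * g k"
  using assms(2)
proof (induction rule: dec_induct)
  case (step n)
  then show ?case using g_antimono[of k n] assms(1) by (simp add: m_Suc algebra_simps)
qed simp

text \<open>The increments from \<open>k\<close> to \<open>n - 1\<close> are all at least
  \<open>g n\<close>. The bound uses \<open>g n\<close> because this is the first increment of an
  extrapolation beyond \<open>n\<close>, to be compared with the secant slope before
  \<open>n\<close>.\<close>

lemma m_diff_ge:
  assumes "1 \<le> k" "k \<le> n"
  shows "(real n - real k) * g n \<le> m n - m k"
  using assms(2)
proof (induction rule: dec_induct)
  case (step n)
  have "(real (Suc n) - real k) * g (Suc n) \<le> (real (Suc n) - real k) * g n"
    using step g_step[of n] assms(1) by (intro mult_left_mono) auto
  also have "\<dots> \<le> m (Suc n) - m k" using step.IH by (simp add: m_Suc algebra_simps)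
  finally show ?case .
qed simp

text \<open>
  By concavity the secant slope over \<open>{l - w..l}\<close> dominates every increment after \<open>l\<close>, so the
  window estimator is optimistic in the mean; it is also bounded by the increment at the left end.
\<close>

lemma window_mean_bounds:
  assumes w: "1 \<le> w" "2 * w \<le> n" and t: "n < t"
  defines "A \<equiv> (\<Sum>l\<in>{1..n}. red_coeff t n w l * m l)"
  shows "m t \<le> A" and "A \<le> m n + real t * g (n - 2 * w + 1)"
proof -
  define f where "f l = m l + (real t - real l) * ((m l - m (l - w)) / real w)" for l
  have A: "A = 1 / real w * (\<Sum>l\<in>{n - w + 1..n}. f l)"
    unfolding A_def f_def by (rule window_sum_eq_red_coeff[OF w, symmetric])
  have card: "card {n - w + 1..n} = w" using w by simp
  have "m t \<le> f l" if "l \<in> {n - w + 1..n}" for l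
  proof -
    have l: "1 \<le> l - w" "w \<le> l" "l \<le> t" "1 \<le> l" using that w t by auto
    have "m t - m l \<le> (real t - real l) * g l" using l by (intro m_diff_le) auto
    also have "\<dots> \<le> (real t - real l) * ((m l - m (l - w)) / real w)"
      using m_diff_ge[of "l - w" l] l w by (intro mult_left_mono) (auto simp: field_simps of_nat_diff)
    finally show ?thesis by (simp add: f_def)
  qed
  then have "of_nat (card {n - w + 1..n}) * m t \<le> (\<Sum>l\<in>{n - w + 1..n}. f l)"
    by (rule sum_bounded_below)
  then show "m t \<le> A" unfolding A card using w by (simp add: field_simps)
  have "f l \<le> m n + real t * g (n - 2 * w + 1)" if "l \<in> {n - w + 1..n}" for l
  proof -
    have l: "1 \<le> l - w" "w \<le> l" "l \<le> t" "1 \<le> l" "l \<le> n" "n - 2 * w + 1 \<le> l - w"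
      using that w t by auto
    have "(m l - m (l - w)) / real w \<le> g (l - w)"
      using m_diff_le[of "l - w" l] l w by (auto simp: field_simps of_nat_diff)
    also have "\<dots> \<le> g (n - 2 * w + 1)" using l by (intro g_antimono) auto
    finally have "(real t - real l) * ((m l - m (l - w)) / real w) \<le> (real t - real l) * g (n - 2 * w + 1)"
      using l by (intro mult_left_mono) auto
    also have "\<dots> \<le> real t * g (n - 2 * w + 1)"
      by (intro mult_right_mono g_nonneg) auto
    finally show ?thesis using m_mono[of l n] l by (simp add: f_def)
  qed
  then have "(\<Sum>l\<in>{n - w + 1..n}. f l) \<le> of_nat (card {n - w + 1..n}) * (m n + real t * g (n - 2 * w + 1))"
    by (rule sum_bounded_above)
  then show "A \<le> m n + real t * g (n - 2 * w + 1)"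
    unfolding A card using w by (simp add: field_simps)
qed

text \<open>Passing from \<open>T\<close> to \<open>Suc T\<close> appends a value that dominates
  each of the first \<open>N\<close>. Cross-multiplication covers \<open>N = 0\<close> as
  well.\<close>

lemma prefix_average_mono:
  assumes "N \<le> T"
  shows "real T * (\<Sum>l\<in>{1..N}. m l) \<le> real N * (\<Sum>l\<in>{1..T}. m l)"
  using assms
proof (induction rule: dec_induct)
  case (step T)
  have "(\<Sum>l\<in>{1..N}. m l) \<le> of_nat (card {1..N}) * m (Suc T)"
    using step by (intro sum_bounded_above m_mono) auto
  with step show ?case by (simp add: algebra_simps)
qed simp

end

lemma rising_armI:
  assumes "rising K \<nu>" "i \<in> {1..K}"
  shows "rising_arm (mean_reward \<nu> i) (increment \<nu> i)"
  using assms by unfold_locales (auto simp: rising_def increment_def)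

section \<open>The oracle benchmark\<close>

text \<open>The return is a sum of prefix sums with lengths \<open>pulls h i T\<close>. Each is at
  most that length divided by \<open>T\<close> times \<open>J\<close>, and the lengths add up to
  \<open>T\<close>.\<close>

lemma policy_return_le:
  assumes rise: "rising K \<nu>" and T: "1 \<le> T"
    and arms: "\<And>t. t \<in> {1..T} \<Longrightarrow> arm_at h t \<in> {1..K}"
    and best: "\<And>i. i \<in> {1..K} \<Longrightarrow> (\<Sum>t\<in>{1..T}. mean_reward \<nu> i t) \<le> J"
  shows "(\<Sum>t\<in>{1..T}. mean_reward \<nu> (arm_at h t) (pulls h (arm_at h t) t)) \<le> J"
proof -
  have "real T * (\<Sum>l\<in>{1..pulls h i T}. mean_reward \<nu> i l) \<le> real (pulls h i T) * J"
    if i: "i \<in> {1..K}" for i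
  proof -
    interpret rising_arm "mean_reward \<nu> i" "increment \<nu> i" by (rule rising_armI[OF rise i])
    have "real T * (\<Sum>l\<in>{1..pulls h i T}. mean_reward \<nu> i l) \<le>
        real (pulls h i T) * (\<Sum>t\<in>{1..T}. mean_reward \<nu> i t)"
      by (rule prefix_average_mono[OF pulls_le])
    also have "\<dots> \<le> real (pulls h i T) * J" using best[OF i] by (intro mult_left_mono) auto
    finally show ?thesis .
  qed
  then have "real T * (\<Sum>i\<in>{1..K}. \<Sum>l\<in>{1..pulls h i T}. mean_reward \<nu> i l) \<le>
      (\<Sum>i\<in>{1..K}. real (pulls h i T) * J)"
    unfolding sum_distrib_left by (rule sum_mono)
  also have "\<dots> = real (\<Sum>i\<in>{1..K}. pulls h i T) * J" by (simp add: sum_distrib_right)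
  also have "(\<Sum>i\<in>{1..K}. pulls h i T) = T" using arms by (intro sum_pulls) auto
  finally show ?thesis
    using T sum_rounds_by_arm[of T h "{1..K}" "mean_reward \<nu>"] arms by simp
qed

section \<open>Splitting the regret of one round\<close>

text \<open>Union bound over arms, guessed counts and signs. The prefactor is t^(-\<alpha>), written
  as an exponential so that it cancels the lower bound \<open>exp a\<close> of the weight.\<close>

definition round_deviation ::
  "nat \<Rightarrow> bandit \<Rightarrow> real \<Rightarrow> real \<Rightarrow> real \<Rightarrow> nat \<Rightarrow> nat \<Rightarrow> history \<Rightarrow> real" where
  "round_deviation K \<nu> \<sigma> \<epsilon> \<alpha> T t h = (\<Sum>i\<in>{1..K}. \<Sum>n\<in>{..<t}. \<Sum>s\<in>{-1, 1}.
     exp (- (\<alpha> * ln (real t))) * deviation_weight \<nu> \<sigma> \<epsilon> (\<alpha> * ln (real t)) T t i n s h)"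

lemma round_deviation_nonneg: "0 \<le> round_deviation K \<nu> \<sigma> \<epsilon> \<alpha> T t h"
  unfolding round_deviation_def by (intro sum_nonneg mult_nonneg_nonneg deviation_weight_nonneg) auto

lemma round_deviation_ge_1:
  assumes t: "t \<in> {1..T}" and i: "i \<in> {1..K}" and n: "n = pulls h i (t - 1)"
    and w: "w = nat \<lfloor>\<epsilon> * real n\<rfloor>" "1 \<le> w" "2 * w \<le> n" and "0 < \<sigma>" "0 \<le> \<alpha>"
    and dev: "\<sigma> * (real t - real n + real w - 1) * sqrt (10 * (\<alpha> * ln (real t)) / real w ^ 3) \<le>
      \<bar>\<Sum>l\<in>{1..n}. red_coeff t n w l * (reward_at h (pull_round h i l) - mean_reward \<nu> i l)\<bar>"
  shows "1 \<le> round_deviation K \<nu> \<sigma> \<epsilon> \<alpha> T t h"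
proof -
  let ?y = "\<Sum>l\<in>{1..n}. red_coeff t n w l * (reward_at h (pull_round h i l) - mean_reward \<nu> i l)"
  let ?d = "\<lambda>i n s. exp (- (\<alpha> * ln (real t))) * deviation_weight \<nu> \<sigma> \<epsilon> (\<alpha> * ln (real t)) T t i n s h"
  have nonneg: "0 \<le> ?d j k s" for j k s by (intro mult_nonneg_nonneg deviation_weight_nonneg) auto
  have nt: "n < t" using pulls_le[of h i "t - 1"] t n by auto
  define s :: real where "s = (if 0 \<le> ?y then 1 else - 1)"
  have s: "s \<in> {-1, 1}" "s\<^sup>2 = 1" "\<bar>?y\<bar> = s * ?y" by (auto simp: s_def)
  have "exp (\<alpha> * ln (real t)) \<le> deviation_weight \<nu> \<sigma> \<epsilon> (\<alpha> * ln (real t)) T t i n s h"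
    by (rule deviation_weight_ge[OF t n w(1) w(2,3) \<open>0 < \<sigma>\<close> _ s(2)])
      (use dev s(3) t \<open>0 \<le> \<alpha>\<close> in auto)
  then have "exp (- (\<alpha> * ln (real t))) * exp (\<alpha> * ln (real t)) \<le> ?d i n s"
    by (intro mult_left_mono) auto
  then have "1 \<le> ?d i n s" by (simp add: exp_add[symmetric])
  also have "\<dots> \<le> (\<Sum>s\<in>{-1, 1}. ?d i n s)"
    using s(1) nonneg by (intro member_le_sum) auto
  also have "\<dots> \<le> (\<Sum>n\<in>{..<t}. \<Sum>s\<in>{-1, 1}. ?d i n s)"
    using nt nonneg by (intro member_le_sum[of n "{..<t}" "\<lambda>n. \<Sum>s\<in>{-1, 1}. ?d i n s"] sum_nonneg) auto
  also have "\<dots> \<le> round_deviation K \<nu> \<sigma> \<epsilon> \<alpha> T t h"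
    unfolding round_deviation_def
    using i nonneg by (intro member_le_sum[of i "{1..K}" "\<lambda>i. \<Sum>n\<in>{..<t}. \<Sum>s\<in>{-1, 1}. ?d i n s"] sum_nonneg) auto
  finally show ?thesis .
qed

text \<open>Capped double bonus, with \<open>t - n + w - 1\<close> and \<open>ln t\<close> enlarged
  to \<open>T\<close> and \<open>ln T\<close> so that it depends on the pull count alone. An empty
  window has an infinite bonus and costs the full 1.\<close>

definition exploration_cost :: "real \<Rightarrow> real \<Rightarrow> real \<Rightarrow> nat \<Rightarrow> nat \<Rightarrow> real" where
  "exploration_cost \<sigma> \<epsilon> \<alpha> T n = (let w = nat \<lfloor>\<epsilon> * real n\<rfloor> in
     if w = 0 then 1 else min 1 (2 * \<sigma> * real T * sqrt (10 * (\<alpha> * ln (real T)) / real w ^ 3)))"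

lemma round_regret_le:
  assumes rested: "rested_bandit K \<nu>" and rise: "rising K \<nu>"
    and ucb: "is_R_ed_UCB K \<sigma> \<epsilon> \<alpha> T \<pi>"
    and pos: "0 < \<sigma>" "0 < \<epsilon>" "\<epsilon> < 1/2" "0 \<le> \<alpha>"
    and h: "h \<in> space (history_space K T)" and t: "t \<in> {1..T}"
    and follows: "arm_at h t = \<pi> (t - 1) (restrict h {0..<t - 1})"
    and j: "j \<in> {1..K}" and i: "i = arm_at h t" and n: "n = pulls h i (t - 1)"
  shows "mean_reward \<nu> j t - mean_reward \<nu> i (n + 1) \<le> round_deviation K \<nu> \<sigma> \<epsilon> \<alpha> T t h +
    exploration_cost \<sigma> \<epsilon> \<alpha> T n + min 1 (real T * increment \<nu> i (n - 2 * nat \<lfloor>\<epsilon> * real n\<rfloor> + 1))"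
proof -
  define w where "w k = nat \<lfloor>\<epsilon> * real (pulls h k (t - 1))\<rfloor>" for k
  define X where "X k l = reward_at h (pull_round h k l)" for k l
  define b where "b k = \<sigma> * (real t - real (pulls h k (t - 1)) + real (w k) - 1)
      * sqrt (10 * (\<alpha> * ln (real t)) / real (w k) ^ 3)" for k
  define est where "est k = (\<Sum>l\<in>{1..pulls h k (t - 1)}. red_coeff t (pulls h k (t - 1)) (w k) l * X k l)" for k
  define avg where "avg k = (\<Sum>l\<in>{1..pulls h k (t - 1)}.
      red_coeff t (pulls h k (t - 1)) (w k) l * mean_reward \<nu> k l)" for k
  have iK: "i \<in> {1..K}" using arm_at_history_space[OF h t] i by simp
  have t1: "1 \<le> t" "t \<le> T" using t by auto
  have range: "0 \<le> mean_reward \<nu> k l" "mean_reward \<nu> k l \<le> 1" if "k \<in> {1..K}" "1 \<le> l" for k l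
    using rested that by (auto simp: rested_bandit_def)
  interpret I: rising_arm "mean_reward \<nu> i" "increment \<nu> i" by (rule rising_armI[OF rise iK])
  interpret J: rising_arm "mean_reward \<nu> j" "increment \<nu> j" by (rule rising_armI[OF rise j])
  have w2: "2 * w k \<le> pulls h k (t - 1)" for k
    unfolding w_def using pos by (intro two_window_le) auto
  have pt: "pulls h k (t - 1) < t" for k using pulls_le[of h k "t - 1"] t1 by auto
  have cost0: "0 \<le> exploration_cost \<sigma> \<epsilon> \<alpha> T n"
    using pos t1 by (auto simp: exploration_cost_def Let_def)
  have incr0: "0 \<le> min 1 (real T * increment \<nu> i (n - 2 * nat \<lfloor>\<epsilon> * real n\<rfloor> + 1))"
    using I.g_nonneg by (auto simp: min_def)
  have le1: "mean_reward \<nu> j t - mean_reward \<nu> i (n + 1) \<le> 1"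
    using range[OF j t1(1)] range[OF iK, of "n + 1"] by simp
  show ?thesis
  \<comment> \<open>Bad rounds: the chosen arm has an empty window or some estimator leaves its
    bonus. The difference of means is at most 1, and one term on the right already reaches
    1.\<close>
  proof (cases "w i = 0 \<or> (\<exists>k\<in>{1..K}. 1 \<le> w k \<and> b k \<le> \<bar>est k - avg k\<bar>)")
    case True
    then show ?thesis
    proof
      assume "w i = 0"
      then have "exploration_cost \<sigma> \<epsilon> \<alpha> T n = 1"
        by (simp add: exploration_cost_def w_def n)
      with le1 incr0 round_deviation_nonneg[of K \<nu> \<sigma> \<epsilon> \<alpha> T t h] show ?thesis by linarith
    next
      assume "\<exists>k\<in>{1..K}. 1 \<le> w k \<and> b k \<le> \<bar>est k - avg k\<bar>"
      then obtain k where k: "k \<in> {1..K}" "1 \<le> w k" "b k \<le> \<bar>est k - avg k\<bar>" by blast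
      have "1 \<le> round_deviation K \<nu> \<sigma> \<epsilon> \<alpha> T t h"
        by (rule round_deviation_ge_1[OF t k(1) refl w_def k(2) w2 pos(1,4)])
          (use k(3) in \<open>simp add: b_def est_def avg_def X_def sum_subtractf right_diff_distrib\<close>)
      with le1 incr0 cost0 show ?thesis by linarith
    qed
  next
    case False
    then have wi: "1 \<le> w i" and good: "\<And>k. k \<in> {1..K} \<Longrightarrow> 1 \<le> w k \<Longrightarrow> \<bar>est k - avg k\<bar> < b k"
      by force+
    have index: "red_index \<sigma> \<epsilon> \<alpha> k t h = ereal (est k + b k)" if "1 \<le> w k" for k
      using red_index_eq[OF refl w_def that w2 t1(1)] by (simp add: est_def X_def b_def)
    have "restrict h {0..<t - 1} \<in> space (history_space K (t - 1))"
      by (rule measurable_space[OF measurable_restrict_history h]) (use t in auto)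
    then have "is_arg_max (\<lambda>k. red_index \<sigma> \<epsilon> \<alpha> k t (restrict h {0..<t - 1})) (\<lambda>k. k \<in> {1..K}) i"
      using ucb t follows by (auto simp: is_R_ed_UCB_def i)
    moreover have "red_index \<sigma> \<epsilon> \<alpha> k t (restrict h {0..<t - 1}) = red_index \<sigma> \<epsilon> \<alpha> k t h" for k
      using pos by (intro red_index_cong) auto
    ultimately have "red_index \<sigma> \<epsilon> \<alpha> j t h \<le> red_index \<sigma> \<epsilon> \<alpha> i t h"
      using j by (simp add: is_arg_max_def not_less)
    then have le: "red_index \<sigma> \<epsilon> \<alpha> j t h \<le> ereal (est i + b i)"
      using index[OF wi] by simp
    \<comment> \<open>An empty window would give \<open>j\<close> an infinite index, above the
      finite one of the chosen arm.\<close>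
    have wj: "1 \<le> w j"
    proof (rule ccontr)
      assume "\<not> 1 \<le> w j"
      then have "w j = 0" by simp
      then have "red_index \<sigma> \<epsilon> \<alpha> j t h = \<infinity>"
        by (intro red_index_infinite) (simp only: red_window_def w_def)
      with le show False by simp
    qed
    have "est j + b j \<le> est i + b i" using le index[OF wj] by simp
    moreover have "mean_reward \<nu> j t \<le> avg j"
      unfolding avg_def by (rule J.window_mean_bounds[OF wj w2 pt])
    moreover have "avg i \<le> mean_reward \<nu> i n + real t * increment \<nu> i (n - 2 * w i + 1)"
      unfolding avg_def n by (rule I.window_mean_bounds[OF wi w2 pt])
    moreover have "mean_reward \<nu> i n \<le> mean_reward \<nu> i (n + 1)"
      using w2[of i] wi by (intro I.m_mono) (auto simp: n)
    \<comment> \<open>The mean of \<open>j\<close> is at most avg j < est j + b j <= est i + b i <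
      avg i + 2 b i, and monotonicity exchanges pull \<open>n\<close> of arm \<open>i\<close> for
      pull \<open>n + 1\<close>.\<close>
    ultimately have "mean_reward \<nu> j t - mean_reward \<nu> i (n + 1) \<le>
        2 * b i + real t * increment \<nu> i (n - 2 * w i + 1)"
      using good[OF j wj] good[OF iK wi] by linarith
    also have "real t * increment \<nu> i (n - 2 * w i + 1) \<le> real T * increment \<nu> i (n - 2 * w i + 1)"
      using t1 I.g_nonneg by (intro mult_right_mono) auto
    also have "2 * b i \<le> 2 * \<sigma> * real T * sqrt (10 * (\<alpha> * ln (real T)) / real (w i) ^ 3)"
    proof -
      have "(real t - real n + real (w i) - 1) * sqrt (10 * (\<alpha> * ln (real t)) / real (w i) ^ 3) \<le>
          real T * sqrt (10 * (\<alpha> * ln (real T)) / real (w i) ^ 3)"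
        using t1 w2[of i] pos pt[of i] wi
        by (intro mult_mono real_sqrt_le_mono divide_right_mono mult_left_mono) (auto simp: n)
      then have "(2 * \<sigma>) * ((real t - real n + real (w i) - 1) * sqrt (10 * (\<alpha> * ln (real t)) / real (w i) ^ 3)) \<le>
          (2 * \<sigma>) * (real T * sqrt (10 * (\<alpha> * ln (real T)) / real (w i) ^ 3))"
        using pos by (intro mult_left_mono) auto
      then show ?thesis by (simp add: b_def n mult.assoc)
    qed
    finally have "mean_reward \<nu> j t - mean_reward \<nu> i (n + 1) \<le>
        2 * \<sigma> * real T * sqrt (10 * (\<alpha> * ln (real T)) / real (w i) ^ 3)
        + real T * increment \<nu> i (n - 2 * w i + 1)" by simp
    moreover have "exploration_cost \<sigma> \<epsilon> \<alpha> T n =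
        min 1 (2 * \<sigma> * real T * sqrt (10 * (\<alpha> * ln (real T)) / real (w i) ^ 3))"
      unfolding exploration_cost_def Let_def n w_def[symmetric] using wi by simp
    moreover have "nat \<lfloor>\<epsilon> * real n\<rfloor> = w i" by (simp add: w_def n)
    \<comment> \<open>The caps come from the trivial bound 1: min 1 (x + y) <= min 1 x + min 1 y for
      nonnegative x and y.\<close>
    ultimately show ?thesis
      using le1 cost0 incr0 round_deviation_nonneg[of K \<nu> \<sigma> \<epsilon> \<alpha> T t h]
      by (simp add: min_def split: if_splits)
  qed
qed

section \<open>Summation over the rounds\<close>

lemma card_nat_interval_le:
  fixes a b :: real
  assumes "0 \<le> a" "a \<le> b" and S: "\<And>n. n \<in> S \<Longrightarrow> a \<le> real n \<and> real n < b"
  shows "real (card S) \<le> b - a + 1"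
proof -
  have "S \<subseteq> {nat \<lceil>a\<rceil>..<nat \<lceil>b\<rceil>}"
  proof
    fix n assume "n \<in> S"
    from S[OF this] have "\<lceil>a\<rceil> \<le> int n" "int n < \<lceil>b\<rceil>"
      by linarith+
    then show "n \<in> {nat \<lceil>a\<rceil>..<nat \<lceil>b\<rceil>}" by (auto simp: ceiling_le_iff)
  qed
  then have "card S \<le> nat \<lceil>b\<rceil> - nat \<lceil>a\<rceil>"
    using card_mono[of "{nat \<lceil>a\<rceil>..<nat \<lceil>b\<rceil>}" S] by simp
  moreover have "nat \<lceil>a\<rceil> \<le> nat \<lceil>b\<rceil>" using assms by (intro nat_mono ceiling_mono)
  ultimately show ?thesis using assms by linarith
qed

text \<open>The \<open>n\<close> sent to a given \<open>l\<close> lie in a half-open real interval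
  of length 1 / c, which contains at most 1 / c + 1 integers.\<close>

lemma sum_floor_compress_le:
  fixes g :: "nat \<Rightarrow> real" and c :: real
  assumes c: "0 < c" and g: "\<And>l. 0 \<le> g l"
    and M: "\<And>n. n < m \<Longrightarrow> nat \<lfloor>c * real n\<rfloor> + 1 \<le> M"
  shows "(\<Sum>n<m. g (nat \<lfloor>c * real n\<rfloor> + 1)) \<le> (1 / c + 1) * (\<Sum>l\<in>{1..M}. g l)"
proof -
  define \<phi> where "\<phi> n = nat \<lfloor>c * real n\<rfloor> + 1" for n
  have "(\<Sum>n<m. g (\<phi> n)) = (\<Sum>l\<in>{1..M}. \<Sum>n\<in>{n \<in> {..<m}. \<phi> n = l}. g (\<phi> n))"
    by (rule sum.group[symmetric]) (use M in \<open>auto simp: \<phi>_def\<close>)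
  also have "\<dots> = (\<Sum>l\<in>{1..M}. real (card {n \<in> {..<m}. \<phi> n = l}) * g l)"
    by (intro sum.cong refl) simp
  also have "\<dots> \<le> (\<Sum>l\<in>{1..M}. (1 / c + 1) * g l)"
  proof (intro sum_mono mult_right_mono g)
    fix l assume l: "l \<in> {1..M}"
    have "real (card {n \<in> {..<m}. \<phi> n = l}) \<le> real l / c - (real l - 1) / c + 1"
    proof (rule card_nat_interval_le)
      fix n assume "n \<in> {n \<in> {..<m}. \<phi> n = l}"
      then have "nat \<lfloor>c * real n\<rfloor> + 1 = l" by (simp add: \<phi>_def)
      moreover have "0 \<le> c * real n" using c by simp
      ultimately have "real l - 1 \<le> c * real n" "c * real n < real l" by linarith+
      then show "(real l - 1) / c \<le> real n \<and> real n < real l / c"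
        using c by (simp add: field_simps)
    qed (use l c in \<open>auto simp: divide_right_mono\<close>)
    then show "real (card {n \<in> {..<m}. \<phi> n = l}) \<le> 1 / c + 1"
      by (simp add: diff_divide_distrib)
  qed
  also have "\<dots> = (1 / c + 1) * (\<Sum>l\<in>{1..M}. g l)" by (rule sum_distrib_left[symmetric])
  finally show ?thesis by (simp add: \<phi>_def)
qed

text \<open>Concavity of the prefix sums: an even split of the \<open>T\<close> pulls is the worst case.\<close>

lemma sum_prefix_sums_le_even_split:
  fixes f :: "nat \<Rightarrow> real" and N :: "nat \<Rightarrow> nat"
  assumes anti: "antimono f" and f: "\<And>n. 0 \<le> f n" "\<And>n. f n \<le> 1"
    and K: "1 \<le> K" and N: "(\<Sum>i\<in>{1..K}. N i) = T"
  shows "(\<Sum>i\<in>{1..K}. \<Sum>n<N i. f n) \<le> real K * (\<Sum>n<T div K. f n) + real K"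
proof -
  define m where "m = T div K"
  \<comment> \<open>Tangent line at the even share \<open>m\<close>: terms from \<open>m\<close> on
    are at most \<open>f m\<close>, terms before it at least \<open>f m\<close>.\<close>
  have "(\<Sum>n<k. f n) \<le> (\<Sum>n<m. f n) + (real k - real m) * f m" for k
  proof (cases "m \<le> k")
    case True
    then have "(\<Sum>n<k. f n) = (\<Sum>n<m. f n) + (\<Sum>n\<in>{m..<k}. f n)"
      by (simp add: sum.atLeastLessThan_concat[of 0 m k, symmetric] lessThan_atLeast0)
    also have "(\<Sum>n\<in>{m..<k}. f n) \<le> of_nat (card {m..<k}) * f m"
      using antimonoD[OF anti] by (intro sum_bounded_above) auto
    finally show ?thesis using True by (simp add: of_nat_diff)
  next
    case False
    then have "(\<Sum>n<m. f n) = (\<Sum>n<k. f n) + (\<Sum>n\<in>{k..<m}. f n)"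
      by (simp add: sum.atLeastLessThan_concat[of 0 k m, symmetric] lessThan_atLeast0)
    moreover have "of_nat (card {k..<m}) * f m \<le> (\<Sum>n\<in>{k..<m}. f n)"
      using antimonoD[OF anti] by (intro sum_bounded_below) auto
    ultimately show ?thesis using False by (simp add: of_nat_diff algebra_simps)
  qed
  then have "(\<Sum>i\<in>{1..K}. \<Sum>n<N i. f n) \<le>
      (\<Sum>i\<in>{1..K}. (\<Sum>n<m. f n) + (real (N i) - real m) * f m)"
    by (rule sum_mono)
  also have "\<dots> = real K * (\<Sum>n<m. f n) + (real (\<Sum>i\<in>{1..K}. N i) - real K * real m) * f m"
    by (simp add: sum.distrib sum_subtractf sum_distrib_right[symmetric])
  \<comment> \<open>The linear parts leave only the remainder of \<open>T\<close> modulo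
    \<open>K\<close>, times \<open>f m\<close>.\<close>
  also have "(real (\<Sum>i\<in>{1..K}. N i) - real K * real m) * f m \<le> real K * 1"
  proof (rule mult_mono)
    have "T < K * m + K"
      using mod_less_divisor[of K T] K mult_div_mod_eq[of K T] unfolding m_def by linarith
    then have "real T < real K * real m + real K" by (metis of_nat_add of_nat_less_iff of_nat_mult)
    then show "real (\<Sum>i\<in>{1..K}. N i) - real K * real m \<le> real K" unfolding N by simp
  qed (use f in auto)
  finally show ?thesis by (simp add: m_def)
qed

text \<open>Telescoping discrete integral. With x = sqrt n and y = sqrt (n + 1), the identity (y -
  x) (y + x) = 1 gives 1 / y^3 <= 2 / x - 2 / y.\<close>

lemma sum_inverse_three_halves_le:
  assumes "1 \<le> k" "k \<le> n"
  shows "(\<Sum>l\<in>{k + 1..n}. 1 / sqrt (real l ^ 3)) \<le> 2 / sqrt (real k) - 2 / sqrt (real n)"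
  using assms(2)
proof (induction rule: dec_induct)
  case (step n)
  define x y where "x = sqrt (real n)" and "y = sqrt (real (Suc n))"
  have x: "0 < x" "x \<le> y" and y2: "y\<^sup>2 = x\<^sup>2 + 1"
    using step assms(1) by (auto simp: x_def y_def)
  have "1 = (y - x) * (y + x)" using y2 by (simp add: power2_eq_square algebra_simps)
  also have "\<dots> \<le> (y - x) * (2 * y)" using x by (intro mult_left_mono) auto
  finally have "1 * x \<le> (y - x) * (2 * y) * y" using x by (intro mult_mono) auto
  then have "1 / y ^ 3 \<le> 2 / x - 2 / y"
    using x by (simp add: field_simps power3_eq_cube)
  then have "1 / sqrt (real (Suc n) ^ 3) \<le> 2 / sqrt (real n) - 2 / sqrt (real (Suc n))"
    by (simp add: x_def y_def real_sqrt_power)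
  with step show ?case by (simp del: of_nat_Suc)
qed simp

lemma exploration_cost_nonneg:
  "0 < \<sigma> \<Longrightarrow> 0 \<le> \<alpha> \<Longrightarrow> 0 \<le> exploration_cost \<sigma> \<epsilon> \<alpha> T n"
  by (cases "T = 0") (auto simp: exploration_cost_def Let_def)

lemma exploration_cost_le_1: "exploration_cost \<sigma> \<epsilon> \<alpha> T n \<le> 1"
  by (simp add: exploration_cost_def Let_def)

lemma exploration_cost_le:
  assumes pos: "0 < \<sigma>" "0 < \<epsilon>" "0 < \<alpha>" "1 \<le> T" and n: "1 \<le> \<epsilon> * real n"
  defines "X \<equiv> (\<sigma> * real T) powr (2/3) * (\<alpha> * ln (real T)) powr (1/3) / \<epsilon>"
  shows "exploration_cost \<sigma> \<epsilon> \<alpha> T n \<le> 18 * sqrt (X ^ 3) * (1 / sqrt (real n ^ 3))"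
proof -
  define w where "w = nat \<lfloor>\<epsilon> * real n\<rfloor>"
  have "1 \<le> w" using n unfolding w_def by linarith
  moreover have "\<epsilon> * real n < real w + 1" unfolding w_def by linarith
  ultimately have w: "1 \<le> w" "\<epsilon> * real n \<le> 2 * real w" by simp_all
  have "0 < n" using n by (cases n) auto
  have L: "0 \<le> \<alpha> * ln (real T)" using pos by simp
  \<comment> \<open>The cube of \<open>\<epsilon> * X\<close> is the squared scale of the bonus, so
    the bonus becomes a multiple of (X / n)^(3/2).\<close>
  have "(\<epsilon> * X) ^ 3 = ((\<sigma> * real T) powr (2/3)) ^ 3 * ((\<alpha> * ln (real T)) powr (1/3)) ^ 3"
    using pos by (simp add: X_def power_mult_distrib)
  also have "((\<sigma> * real T) powr (2/3)) ^ 3 = (\<sigma> * real T)\<^sup>2"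
    using pos by (simp add: powr_power powr_numeral)
  also have "((\<alpha> * ln (real T)) powr (1/3)) ^ 3 = \<alpha> * ln (real T)"
    using L by (cases "\<alpha> = 0 \<or> ln (real T) = 0") (auto simp: powr_power)
  finally have cube: "(\<epsilon> * X) ^ 3 = (\<sigma> * real T)\<^sup>2 * (\<alpha> * ln (real T))" .
  have "exploration_cost \<sigma> \<epsilon> \<alpha> T n \<le> 2 * \<sigma> * real T * sqrt (10 * (\<alpha> * ln (real T)) / real w ^ 3)"
    using w(1) by (simp add: exploration_cost_def Let_def w_def[symmetric])
  also have "\<dots> = 2 * (\<sigma> * real T) * sqrt (10 * (\<alpha> * ln (real T)) / real w ^ 3)"
    by (simp only: mult.assoc)
  also have "\<dots> = sqrt (4 * (\<sigma> * real T)\<^sup>2 * (10 * (\<alpha> * ln (real T)) / real w ^ 3))"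
    using pos unfolding real_sqrt_mult[of _ "10 * (\<alpha> * ln (real T)) / real w ^ 3"]
    by (simp add: real_sqrt_mult)
  also have "\<dots> = sqrt (40 * (\<epsilon> * X) ^ 3 / real w ^ 3)"
    unfolding cube by (simp add: mult_ac)
  \<comment> \<open>Flooring at most halves the window: w >= \<epsilon> n / 2 turns 40 into 40 * 8 =
    320, rounded up to 324 = 18^2.\<close>
  also have "\<dots> \<le> sqrt (324 * X ^ 3 / real n ^ 3)"
  proof (rule real_sqrt_le_mono)
    have X0: "0 \<le> X" using pos by (simp add: X_def)
    have "(\<epsilon> * real n) ^ 3 \<le> (2 * real w) ^ 3" using w(2) pos by (intro power_mono) auto
    then have "40 * (\<epsilon> * real n) ^ 3 \<le> 320 * real w ^ 3" by (simp add: power_mult_distrib)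
    also have "\<dots> \<le> 324 * real w ^ 3" by simp
    finally have "X ^ 3 * (40 * (\<epsilon> * real n) ^ 3) \<le> X ^ 3 * (324 * real w ^ 3)"
      using X0 by (intro mult_left_mono) auto
    then show "40 * (\<epsilon> * X) ^ 3 / real w ^ 3 \<le> 324 * X ^ 3 / real n ^ 3"
      using w(1) \<open>0 < n\<close> by (simp add: field_simps power_mult_distrib)
  qed
  also have "\<dots> = 18 * sqrt (X ^ 3) * (1 / sqrt (real n ^ 3))"
    using real_sqrt_abs[of 18] by (simp add: real_sqrt_mult real_sqrt_divide)
  finally show ?thesis .
qed

text \<open>Split at \<open>k\<close>, the ceiling of X = Y / \<epsilon>. The first k + 1 <= X + 2
  <= 3 X terms cost at most 1 each, and the tail at most 18 X sqrt X * 2 / sqrt X = 36 X.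
  \<open>1 \<le> Y\<close> makes the windows in the tail nonempty.\<close>

lemma sum_exploration_cost_le:
  assumes pos: "0 < \<sigma>" "0 < \<epsilon>" "\<epsilon> < 1" "0 < \<alpha>" "1 \<le> T"
  defines "Y \<equiv> (\<sigma> * real T) powr (2/3) * (\<alpha> * ln (real T)) powr (1/3)"
  assumes Y: "1 \<le> Y"
  shows "(\<Sum>n<T. exploration_cost \<sigma> \<epsilon> \<alpha> T n) \<le> 39 * (Y / \<epsilon>)"
proof -
  define X where "X = Y / \<epsilon>"
  define k where "k = nat \<lceil>X\<rceil>"
  have X1: "1 \<le> X" using pos Y by (simp add: X_def field_simps)
  have k: "1 \<le> k" "X \<le> real k" "real k \<le> X + 1" using X1 unfolding k_def by linarith+
  have "(\<Sum>n<T. exploration_cost \<sigma> \<epsilon> \<alpha> T n) \<le> (\<Sum>n\<in>{..k} \<union> {k + 1..max k T}. exploration_cost \<sigma> \<epsilon> \<alpha> T n)"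
    using exploration_cost_nonneg pos by (intro sum_mono2) auto
  also have "\<dots> = (\<Sum>n\<in>{..k}. exploration_cost \<sigma> \<epsilon> \<alpha> T n) + (\<Sum>n\<in>{k + 1..max k T}. exploration_cost \<sigma> \<epsilon> \<alpha> T n)"
    by (rule sum.union_disjoint) auto
  also have "(\<Sum>n\<in>{..k}. exploration_cost \<sigma> \<epsilon> \<alpha> T n) \<le> of_nat (card {..k}) * 1"
    by (intro sum_bounded_above exploration_cost_le_1)
  also have "(\<Sum>n\<in>{k + 1..max k T}. exploration_cost \<sigma> \<epsilon> \<alpha> T n) \<le>
      (\<Sum>n\<in>{k + 1..max k T}. 18 * sqrt (X ^ 3) * (1 / sqrt (real n ^ 3)))"
  proof (rule sum_mono)
    fix n assume "n \<in> {k + 1..max k T}"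
    then have "X \<le> real n" using k by auto
    then have "Y \<le> \<epsilon> * real n" using pos by (simp add: X_def field_simps)
    then have "1 \<le> \<epsilon> * real n" using Y by simp
    then show "exploration_cost \<sigma> \<epsilon> \<alpha> T n \<le> 18 * sqrt (X ^ 3) * (1 / sqrt (real n ^ 3))"
      unfolding X_def Y_def using pos by (intro exploration_cost_le) auto
  qed
  also have "\<dots> = 18 * sqrt (X ^ 3) * (\<Sum>n\<in>{k + 1..max k T}. 1 / sqrt (real n ^ 3))"
    by (rule sum_distrib_left[symmetric])
  also have "\<dots> \<le> 18 * sqrt (X ^ 3) * (2 / sqrt X)"
  proof (rule mult_left_mono)
    have "(\<Sum>n\<in>{k + 1..max k T}. 1 / sqrt (real n ^ 3)) \<le> 2 / sqrt (real k) - 2 / sqrt (real (max k T))"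
      using k by (intro sum_inverse_three_halves_le) auto
    also have "\<dots> \<le> 2 / sqrt (real k)" by simp
    also have "\<dots> \<le> 2 / sqrt X" using k X1 by (intro divide_left_mono) auto
    finally show "(\<Sum>n\<in>{k + 1..max k T}. 1 / sqrt (real n ^ 3)) \<le> 2 / sqrt X" .
  qed (use X1 in auto)
  also have "sqrt (X ^ 3) = X * sqrt X"
    using X1 by (simp add: power3_eq_cube real_sqrt_mult)
  finally show ?thesis using k X1 by (simp add: X_def[symmetric])
qed

text \<open>The second condition lets the leading term absorb the harmonic sum of failures, the
  third the additive constants. No bandit, policy or number of arms enters, so the threshold is
  uniform in them.\<close>

lemma eventually_horizon_large:
  fixes \<sigma> \<alpha> c :: real
  assumes "0 < \<sigma>" "0 < \<alpha>"
  shows "\<forall>\<^sub>F T::nat in at_top. 1 \<le> T \<and>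
    1 + ln (real T) \<le> (\<sigma> * real T) powr (2/3) * (\<alpha> * ln (real T)) powr (1/3) \<and>
    c \<le> (\<sigma> * real T) powr (2/3) * (\<alpha> * ln (real T)) powr (1/3)"
proof (intro eventually_conj)
  show "\<forall>\<^sub>F T::nat in at_top. 1 \<le> T" by (rule eventually_ge_at_top)
  show "\<forall>\<^sub>F T::nat in at_top. 1 + ln (real T) \<le> (\<sigma> * real T) powr (2/3) * (\<alpha> * ln (real T)) powr (1/3)"
    using assms by real_asymp
  show "\<forall>\<^sub>F T::nat in at_top. c \<le> (\<sigma> * real T) powr (2/3) * (\<alpha> * ln (real T)) powr (1/3)"
    using assms by real_asymp
qed

section \<open>Expected regret\<close>

text \<open>Round \<open>t\<close> has 2 K t summands of mean at most t^(-\<alpha>) <= t^(-2), hence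
  contributes at most 2 K / t.\<close>

lemma expected_round_deviation_le:
  assumes "interaction K \<nu> \<pi>" "subgaussian_rewards K \<nu> \<sigma>" "2 \<le> \<alpha>"
  shows "(\<integral>\<^sup>+h. ennreal (\<Sum>t\<in>{1..T}. round_deviation K \<nu> \<sigma> \<epsilon> \<alpha> T t h) \<partial>history_law K \<nu> \<pi> T)
    \<le> ennreal (2 * real K * harm T)"
proof -
  interpret interaction K \<nu> \<pi> by fact
  define d where "d t i n s h = exp (- (\<alpha> * ln (real t))) * deviation_weight \<nu> \<sigma> \<epsilon> (\<alpha> * ln (real t)) T t i n s h"
    for t i n s h
  have d0: "0 \<le> d t i n s h" for t i n s h
    unfolding d_def by (intro mult_nonneg_nonneg deviation_weight_nonneg) auto
  have meas: "deviation_weight \<nu> \<sigma> \<epsilon> a T t i n s \<in> borel_measurable (law T)" for a t i n s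
    unfolding measurable_cong_sets[OF sets_law refl] by (rule measurable_deviation_weight)
  have d_meas [measurable]: "d t i n s \<in> borel_measurable (law T)" for t i n s
    unfolding d_def using meas by measurable
  have d_int: "(\<integral>\<^sup>+h. ennreal (d t i n s h) \<partial>law T) \<le> ennreal (1 / (real t)\<^sup>2)" if t: "1 \<le> t" for t i n s
  proof -
    have "(\<integral>\<^sup>+h. ennreal (d t i n s h) \<partial>law T) = ennreal (exp (- (\<alpha> * ln (real t)))) *
        (\<integral>\<^sup>+h. ennreal (deviation_weight \<nu> \<sigma> \<epsilon> (\<alpha> * ln (real t)) T t i n s h) \<partial>law T)"
      unfolding d_def using meas deviation_weight_nonneg
      by (subst nn_integral_cmult[symmetric]) (auto simp: ennreal_mult)
    also have "\<dots> \<le> ennreal (exp (- (\<alpha> * ln (real t)))) * 1"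
      by (intro mult_left_mono nn_integral_deviation_weight_le_1 assms) auto
    also have "exp (- (\<alpha> * ln (real t))) \<le> exp (- (2 * ln (real t)))"
      using t assms by (auto intro!: mult_right_mono)
    also have "exp (- (2 * ln (real t))) = 1 / (real t)\<^sup>2"
      using t by (simp add: exp_minus exp_double field_simps)
    finally show ?thesis by (simp add: ennreal_leI)
  qed
  have "(\<integral>\<^sup>+h. ennreal (\<Sum>t\<in>{1..T}. round_deviation K \<nu> \<sigma> \<epsilon> \<alpha> T t h) \<partial>law T) =
      (\<Sum>t\<in>{1..T}. \<Sum>i\<in>{1..K}. \<Sum>n\<in>{..<t}. \<Sum>s\<in>{-1, 1}. \<integral>\<^sup>+h. ennreal (d t i n s h) \<partial>law T)"
    unfolding round_deviation_def d_def[symmetric]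
    by (simp add: sum_ennreal[symmetric] sum_nonneg d0 nn_integral_sum nn_integral_add
        del: sum_ennreal)
  also have "\<dots> \<le> (\<Sum>t\<in>{1..T}. \<Sum>i\<in>{1..K}. \<Sum>n\<in>{..<t}. \<Sum>s\<in>{-1::real, 1}. ennreal (1 / (real t)\<^sup>2))"
    by (intro sum_mono d_int) auto
  also have "\<dots> = (\<Sum>t\<in>{1..T}. ennreal (2 * real K * inverse (real t)))"
    by (intro sum.cong refl)
      (auto simp: ennreal_of_nat_eq_real_of_nat ennreal_mult[symmetric] ennreal_numeral[symmetric]
        power2_eq_square field_simps simp del: ennreal_numeral)
  also have "\<dots> = ennreal (2 * real K * harm T)"
    unfolding harm_def by (subst sum_ennreal) (auto simp: sum_distrib_left)
  finally show ?thesis .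
qed

context interaction
begin

lemma arm_at_law: "h \<in> space (law n) \<Longrightarrow> t \<in> {1..n} \<Longrightarrow> arm_at h t \<in> {1..K}"
  unfolding space_law by (rule arm_at_history_space)

lemma measurable_return:
  "(\<lambda>h. \<Sum>t\<in>{1..T}. mean_reward \<nu> (arm_at h t) (pulls h (arm_at h t) t)) \<in> borel_measurable (law T)"
  unfolding measurable_cong_sets[OF sets_law refl]
  by (intro borel_measurable_sum measurable_arm_pulls) auto

lemma return_bounds:
  assumes h: "h \<in> space (law T)"
  shows "0 \<le> (\<Sum>t\<in>{1..T}. mean_reward \<nu> (arm_at h t) (pulls h (arm_at h t) t))"
    and "(\<Sum>t\<in>{1..T}. mean_reward \<nu> (arm_at h t) (pulls h (arm_at h t) t)) \<le> real T"
proof -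
  have *: "mean_reward \<nu> (arm_at h t) (pulls h (arm_at h t) t) \<in> {0..1}" if t: "t \<in> {1..T}" for t
  proof -
    have "arm_at h t \<in> {1..K}" using h t by (rule arm_at_law)
    moreover have "1 \<le> pulls h (arm_at h t) t" using t pulls_pred[of t h] by auto
    ultimately show ?thesis using rested unfolding rested_bandit_def by blast
  qed
  then show "0 \<le> (\<Sum>t\<in>{1..T}. mean_reward \<nu> (arm_at h t) (pulls h (arm_at h t) t))"
    by (intro sum_nonneg) auto
  show "(\<Sum>t\<in>{1..T}. mean_reward \<nu> (arm_at h t) (pulls h (arm_at h t) t)) \<le> real T"
    using sum_bounded_above[of "{1..T}" "\<lambda>t. mean_reward \<nu> (arm_at h t) (pulls h (arm_at h t) t)" 1] *
    by auto
qed

lemma integrable_return: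
  "integrable (law T) (\<lambda>h. \<Sum>t\<in>{1..T}. mean_reward \<nu> (arm_at h t) (pulls h (arm_at h t) t))"
proof -
  interpret L: prob_space "law T" by (rule prob_space_law)
  show ?thesis
    by (rule L.integrable_const_bound[where B = "real T"])
      (use return_bounds measurable_return in auto)
qed

lemma expected_return_le:
  assumes "rising K \<nu>" "1 \<le> T"
    and "\<And>i. i \<in> {1..K} \<Longrightarrow> (\<Sum>t\<in>{1..T}. mean_reward \<nu> i t) \<le> J"
  shows "expected_return K \<nu> \<pi> T \<le> J"
proof -
  interpret L: prob_space "law T" by (rule prob_space_law)
  show ?thesis
    unfolding expected_return_def
    by (intro L.integral_le_const integrable_return AE_I2 policy_return_le[OF assms(1,2)] assms(3) arm_at_law)
qed

text \<open>Passes from a pathwise bound to expectations. Integrability of \<open>W\<close> comes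
  from its finite nonnegative integral; the pathwise bound is almost sure because only almost every
  history follows the policy.\<close>

lemma expected_return_ge:
  assumes W: "W \<in> borel_measurable (law T)" "\<And>h. 0 \<le> W h"
    and int: "(\<integral>\<^sup>+h. ennreal (W h) \<partial>law T) \<le> ennreal w" "0 \<le> w"
    and le: "AE h in law T. J - (\<Sum>t\<in>{1..T}. mean_reward \<nu> (arm_at h t) (pulls h (arm_at h t) t)) \<le> W h + c"
  shows "J - expected_return K \<nu> \<pi> T \<le> w + c"
proof -
  interpret L: prob_space "law T" by (rule prob_space_law)
  have intW: "integrable (law T) W"
    using W int by (intro integrableI_nonneg) (auto intro: le_less_trans)
  have "(\<integral>h. W h \<partial>law T) \<le> w"
    using nn_integral_eq_integral[OF intW] W int by simp
  have "J - c - (\<integral>h. W h \<partial>law T) = (\<integral>h. J - c - W h \<partial>law T)"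
    using intW by (simp add: L.prob_space)
  also have "\<dots> \<le> expected_return K \<nu> \<pi> T"
    unfolding expected_return_def
    by (rule integral_mono_AE) (use intW integrable_return le in auto)
  finally show ?thesis using \<open>(\<integral>h. W h \<partial>law T) \<le> w\<close> by simp
qed

end

lemma regret_le:
  assumes "rested_bandit K \<nu>" "is_policy K \<pi>" "rising K \<nu>" "1 \<le> T"
    and best: "\<And>i. i \<in> {1..K} \<Longrightarrow> (\<Sum>t\<in>{1..T}. mean_reward \<nu> i t) \<le> J"
  shows "regret K \<nu> \<pi> T \<le> J - expected_return K \<nu> \<pi> T"
proof -
  have "expected_return K \<nu> \<pi>' T \<le> J" if "is_policy K \<pi>'" for \<pi>'
    using that assms by (intro interaction.expected_return_le interaction.intro)
  \<comment> \<open>A real supremum inherits an upper bound only over a nonempty set; \<pi> is a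
    member.\<close>
  then have "(SUP \<pi>'\<in>{\<pi>'. is_policy K \<pi>'}. expected_return K \<nu> \<pi>' T) \<le> J"
    using assms(2) by (intro cSUP_least) auto
  then show ?thesis by (simp add: regret_def)
qed

text \<open>The power \<open>q\<close> enters through \<open>min 1 x \<le> min 1 (x powr q)\<close>.\<close>

lemma sum_increment_cost_le:
  fixes \<epsilon> q :: real and N :: "nat \<Rightarrow> nat"
  assumes K: "1 \<le> K" and rise: "rising K \<nu>" and eps: "0 < \<epsilon>" "\<epsilon> < 1/2" and q: "0 \<le> q" "q \<le> 1"
    and T: "1 \<le> T" and N: "(\<Sum>i\<in>{1..K}. N i) = T"
  defines "c \<equiv> 1 - 2 * \<epsilon>"
  shows "(\<Sum>i\<in>{1..K}. \<Sum>n<N i. min 1 (real T * increment \<nu> i (n - 2 * nat \<lfloor>\<epsilon> * real n\<rfloor> + 1)))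
    \<le> real K * (2 / c * (real T powr q * cumulative_increment K \<nu> (nat \<lceil>c * (real T / real K)\<rceil>) q + 1)) + real K"
proof -
  define G where "G l = (MAX i\<in>{1..K}. if q = 0 then 1 else increment \<nu> i l powr q)" for l
  \<comment> \<open>The value 1 at index 0 makes \<open>g\<close> antitone on all naturals, whereas
    increments are controlled only from pull 1 on.\<close>
  define g where "g l = (if l = 0 then 1 else min 1 (real T powr q * G l))" for l
  define M where "M = nat \<lceil>c * (real T / real K)\<rceil>"
  define \<phi> where "\<phi> n = nat \<lfloor>c * real n\<rfloor> + 1" for n
  have c: "0 < c" "c < 1" using eps by (auto simp: c_def)
  have ne: "{1..K} \<noteq> {}" using K by auto
  have incr: "0 \<le> increment \<nu> i l" "\<And>k. 1 \<le> k \<Longrightarrow> k \<le> l \<Longrightarrow> increment \<nu> i l \<le> increment \<nu> i k"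
    if "i \<in> {1..K}" "1 \<le> l" for i l
    using rising_arm.g_nonneg[OF rising_armI] rising_arm.g_antimono[OF rising_armI] rise that by blast+
  have G_ge: "(if q = 0 then 1 else increment \<nu> i l powr q) \<le> G l" if "i \<in> {1..K}" for i l
    unfolding G_def using that by (intro Max_ge) auto
  have G0: "0 \<le> G l" for l
    using G_ge[of 1 l] K by (auto intro: order_trans[rotated] split: if_splits)
  have G_anti: "G l \<le> G k" if "1 \<le> k" "k \<le> l" for k l
    unfolding G_def[of l]
  proof (rule Max.boundedI)
    fix y assume "y \<in> (\<lambda>i. if q = 0 then 1 else increment \<nu> i l powr q) ` {1..K}"
    then obtain i where i: "i \<in> {1..K}" and y: "y = (if q = 0 then 1 else increment \<nu> i l powr q)"
      by blast
    have "y \<le> (if q = 0 then 1 else increment \<nu> i k powr q)"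
      unfolding y using incr[OF i, of l] that q by (auto intro!: powr_mono2)
    also have "\<dots> \<le> G k" by (rule G_ge[OF i])
    finally show "y \<le> G k" .
  qed (use ne in auto)
  have g: "0 \<le> g l" "g l \<le> 1" for l using G0 by (auto simp: g_def)
  have g_anti: "antimono g"
  proof (rule antimonoI)
    fix k l :: nat assume "k \<le> l"
    then show "g l \<le> g k"
      using G_anti[of k l] g(2)[of l] mult_left_mono[of "G l" "G k" "real T powr q"]
      by (cases "k = 0") (auto simp: g_def min_def)
  qed
  have step: "min 1 (real T * increment \<nu> i (n - 2 * nat \<lfloor>\<epsilon> * real n\<rfloor> + 1)) \<le> g (\<phi> n)"
    if i: "i \<in> {1..K}" for i n
  proof -
    define x where "x = real T * increment \<nu> i (\<phi> n)"
    have x0: "0 \<le> x" using incr[OF i] by (simp add: x_def \<phi>_def)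
    have "2 * nat \<lfloor>\<epsilon> * real n\<rfloor> \<le> n" using eps by (intro two_window_le) auto
    moreover have "c * real n = real n - 2 * (\<epsilon> * real n)" by (simp add: c_def algebra_simps)
    moreover have "0 \<le> \<epsilon> * real n" "0 \<le> c * real n" using eps c by auto
    \<comment> \<open>Dropping the floor of \<epsilon> n only lowers the index, and an earlier
      increment is at least as large.\<close>
    ultimately have "\<phi> n \<le> n - 2 * nat \<lfloor>\<epsilon> * real n\<rfloor> + 1"
      unfolding \<phi>_def by linarith
    then have "increment \<nu> i (n - 2 * nat \<lfloor>\<epsilon> * real n\<rfloor> + 1) \<le> increment \<nu> i (\<phi> n)"
      using i by (intro incr) (auto simp: \<phi>_def)
    then have "real T * increment \<nu> i (n - 2 * nat \<lfloor>\<epsilon> * real n\<rfloor> + 1) \<le> x"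
      unfolding x_def by (intro mult_left_mono) auto
    then have "min 1 (real T * increment \<nu> i (n - 2 * nat \<lfloor>\<epsilon> * real n\<rfloor> + 1)) \<le> min 1 x"
      by (auto simp: min_def)
    also have "\<dots> \<le> min 1 (real T powr q * (if q = 0 then 1 else increment \<nu> i (\<phi> n) powr q))"
    proof (cases "q = 0")
      case False
      have "min 1 x \<le> min 1 (x powr q)"
      proof (cases "1 \<le> x")
        case True
        then have "1 \<le> x powr q" using q by (intro ge_one_powr_ge_zero) auto
        then show ?thesis by simp
      next
        case F: False
        have "x \<le> x powr q"
        proof (cases "x = 0")
          case False
          then have "x powr 1 \<le> x powr q" using F x0 q by (intro powr_mono') auto
          then show ?thesis using x0 by simp
        qed simp
        then show ?thesis by (auto simp: min_def)
      qed
      also have "x powr q = real T powr q * increment \<nu> i (\<phi> n) powr q"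
        using incr(1)[OF i, of "\<phi> n"] by (simp add: x_def powr_mult \<phi>_def)
      finally show ?thesis using False by simp
    qed (use T in auto)
    also have "\<dots> \<le> min 1 (real T powr q * G (\<phi> n))"
      using G_ge[OF i] by (intro min.mono mult_left_mono) auto
    finally show ?thesis by (simp add: g_def \<phi>_def)
  qed
  have phi_mono: "\<phi> k \<le> \<phi> l" if "k \<le> l" for k l
    using that c unfolding \<phi>_def by (intro add_mono nat_mono floor_mono mult_left_mono) auto
  have "(\<Sum>i\<in>{1..K}. \<Sum>n<N i. min 1 (real T * increment \<nu> i (n - 2 * nat \<lfloor>\<epsilon> * real n\<rfloor> + 1)))
      \<le> (\<Sum>i\<in>{1..K}. \<Sum>n<N i. g (\<phi> n))"
    by (intro sum_mono step)
  also have "\<dots> \<le> real K * (\<Sum>n<T div K. g (\<phi> n)) + real K"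
    using g antimonoD[OF g_anti] phi_mono K N
    by (intro sum_prefix_sums_le_even_split) (auto intro!: antimonoI)
  also have "(\<Sum>n<T div K. g (\<phi> n)) \<le> (1 / c + 1) * (\<Sum>l\<in>{1..M}. g l)"
    unfolding \<phi>_def
  proof (rule sum_floor_compress_le[OF c(1) g(1)])
    \<comment> \<open>The strict inequality gives c n < c T / K, so the floor on the left plus 1
      still fits under the ceiling \<open>M\<close>.\<close>
    fix n assume "n < T div K"
    then have "Suc n * K \<le> T"
      using K less_eq_div_iff_mult_less_eq[of K "Suc n" T] by simp
    then have "n * K < T" using K by simp
    then have "real n * real K < real T" by (metis of_nat_less_iff of_nat_mult)
    then have "c * real n < c * (real T / real K)" using K c by (simp add: field_simps)
    then show "nat \<lfloor>c * real n\<rfloor> + 1 \<le> M"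
      unfolding M_def using c mult_nonneg_nonneg[of c "real n"] by linarith
  qed
  also have "(1 / c + 1) * (\<Sum>l\<in>{1..M}. g l) \<le>
      2 / c * (real T powr q * cumulative_increment K \<nu> M q + 1)"
  proof (rule mult_mono)
    show "1 / c + 1 \<le> 2 / c" using c by (simp add: field_simps)
    \<comment> \<open>The cumulative increment stops at \<open>M - 1\<close>; the extra term is paid
      by the cap 1.\<close>
    have "(\<Sum>l\<in>{1..M}. g l) \<le> (\<Sum>l\<in>{1..<M}. g l) + 1"
    proof (cases M)
      case (Suc k)
      have "{1..M} = insert M {1..<M}" using Suc by auto
      then show ?thesis using g(2)[of M] by simp
    qed simp
    also have "(\<Sum>l\<in>{1..<M}. g l) \<le> (\<Sum>l\<in>{1..<M}. real T powr q * G l)"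
      by (intro sum_mono) (auto simp: g_def)
    also have "\<dots> = real T powr q * cumulative_increment K \<nu> M q"
      by (simp add: cumulative_increment_def G_def sum_distrib_left)
    finally show "(\<Sum>l\<in>{1..M}. g l) \<le> real T powr q * cumulative_increment K \<nu> M q + 1"
      by simp
  qed (use c g in \<open>auto intro: sum_nonneg\<close>)
  finally show ?thesis
    using K by (simp add: M_def)
qed

lemma harm_le_ln:
  assumes "1 \<le> n"
  shows "harm n \<le> 1 + ln (real n)"
  using euler_mascheroni_sequence_decreasing[of 1 n] assms by (simp add: harm_def)

lemma pathwise_regret_le:
  assumes rested: "rested_bandit K \<nu>" and rise: "rising K \<nu>"
    and ucb: "is_R_ed_UCB K \<sigma> \<epsilon> \<alpha> T \<pi>"
    and pos: "0 < \<sigma>" "0 < \<epsilon>" "\<epsilon> < 1/2" "0 \<le> \<alpha>"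
    and h: "h \<in> space (history_space K T)"
    and follows: "\<forall>t\<in>{1..T}. arm_at h t = \<pi> (t - 1) (restrict h {0..<t - 1})"
    and j: "j \<in> {1..K}"
  shows "(\<Sum>t\<in>{1..T}. mean_reward \<nu> j t) - (\<Sum>t\<in>{1..T}. mean_reward \<nu> (arm_at h t) (pulls h (arm_at h t) t))
    \<le> (\<Sum>t\<in>{1..T}. round_deviation K \<nu> \<sigma> \<epsilon> \<alpha> T t h) +
      (real K * (\<Sum>n<T. exploration_cost \<sigma> \<epsilon> \<alpha> T n) +
       (\<Sum>i\<in>{1..K}. \<Sum>n<pulls h i T. min 1 (real T * increment \<nu> i (n - 2 * nat \<lfloor>\<epsilon> * real n\<rfloor> + 1))))"
proof -
  define cost where "cost i n = exploration_cost \<sigma> \<epsilon> \<alpha> T n +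
      min 1 (real T * increment \<nu> i (n - 2 * nat \<lfloor>\<epsilon> * real n\<rfloor> + 1))" for i n
  have arms: "arm_at h t \<in> {1..K}" if "t \<in> {1..T}" for t
    using h that by (rule arm_at_history_space)
  have "(\<Sum>t\<in>{1..T}. mean_reward \<nu> j t) - (\<Sum>t\<in>{1..T}. mean_reward \<nu> (arm_at h t) (pulls h (arm_at h t) t))
      = (\<Sum>t\<in>{1..T}. mean_reward \<nu> j t - mean_reward \<nu> (arm_at h t) (pulls h (arm_at h t) t))"
    by (rule sum_subtractf[symmetric])
  \<comment> \<open>The cost is a function of the count before the pull, hence the
    \<open>- 1\<close>.\<close>
  also have "\<dots> \<le> (\<Sum>t\<in>{1..T}. round_deviation K \<nu> \<sigma> \<epsilon> \<alpha> T t h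
      + cost (arm_at h t) (pulls h (arm_at h t) t - 1))"
  proof (rule sum_mono)
    fix t assume t: "t \<in> {1..T}"
    then have "pulls h (arm_at h t) t = pulls h (arm_at h t) (t - 1) + 1"
      using pulls_pred[of t h] by simp
    then show "mean_reward \<nu> j t - mean_reward \<nu> (arm_at h t) (pulls h (arm_at h t) t) \<le>
        round_deviation K \<nu> \<sigma> \<epsilon> \<alpha> T t h + cost (arm_at h t) (pulls h (arm_at h t) t - 1)"
      using round_regret_le[OF rested rise ucb pos h t bspec[OF follows t] j refl refl]
      by (simp add: cost_def)
  qed
  also have "\<dots> = (\<Sum>t\<in>{1..T}. round_deviation K \<nu> \<sigma> \<epsilon> \<alpha> T t h)
      + (\<Sum>t\<in>{1..T}. cost (arm_at h t) (pulls h (arm_at h t) t - 1))"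
    by (rule sum.distrib)
  also have "(\<Sum>t\<in>{1..T}. cost (arm_at h t) (pulls h (arm_at h t) t - 1))
      = (\<Sum>i\<in>{1..K}. \<Sum>l\<in>{1..pulls h i T}. cost i (l - 1))"
    using arms by (intro sum_rounds_by_arm[where f = "\<lambda>i l. cost i (l - 1)"]) auto
  also have "\<dots> = (\<Sum>i\<in>{1..K}. \<Sum>n<pulls h i T. exploration_cost \<sigma> \<epsilon> \<alpha> T n) +
      (\<Sum>i\<in>{1..K}. \<Sum>n<pulls h i T. min 1 (real T * increment \<nu> i (n - 2 * nat \<lfloor>\<epsilon> * real n\<rfloor> + 1)))"
    by (simp add: sum.atLeast1_atMost_eq cost_def sum.distrib)
  \<comment> \<open>Extending each arm to \<open>T\<close> pulls produces the factor
    \<open>K\<close> of the leading term. The increment costs keep the true counts for the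
    even-split argument.\<close>
  also have "(\<Sum>i\<in>{1..K}. \<Sum>n<pulls h i T. exploration_cost \<sigma> \<epsilon> \<alpha> T n) \<le>
      (\<Sum>i\<in>{1..K}. \<Sum>n<T. exploration_cost \<sigma> \<epsilon> \<alpha> T n)"
    using pos pulls_le[of h _ T] by (intro sum_mono sum_mono2 exploration_cost_nonneg) auto
  finally show ?thesis by simp
qed

lemma regret_R_ed_UCB_le:
  assumes rested: "rested_bandit K \<nu>" and rise: "rising K \<nu>" and sub: "subgaussian_rewards K \<nu> \<sigma>"
    and ucb: "is_R_ed_UCB K \<sigma> \<epsilon> \<alpha> T \<pi>"
    and pos: "0 < \<sigma>" "0 < \<epsilon>" "\<epsilon> < 1/2" "2 < \<alpha>" and q: "0 \<le> q" "q \<le> 1" and T: "1 \<le> T"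
  defines "Y \<equiv> (\<sigma> * real T) powr (2/3) * (\<alpha> * ln (real T)) powr (1/3)"
  assumes Y: "1 + ln (real T) \<le> Y" "2 / (1 - 2 * \<epsilon>) + 1 \<le> Y"
  shows "regret K \<nu> \<pi> T \<le> 42 * (real K / \<epsilon> * Y + real K * real T powr q / (1 - 2 * \<epsilon>) *
    cumulative_increment K \<nu> (nat \<lceil>(1 - 2 * \<epsilon>) * (real T / real K)\<rceil>) q)"
proof -
  define U where "U = real T powr q * cumulative_increment K \<nu> (nat \<lceil>(1 - 2 * \<epsilon>) * (real T / real K)\<rceil>) q"
  define S where "S i = (\<Sum>t\<in>{1..T}. mean_reward \<nu> i t)" for i
  define D where "D = real K * (39 * (Y / \<epsilon>)) + (real K * (2 / (1 - 2 * \<epsilon>) * (U + 1)) + real K)"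
  have K: "1 \<le> K" using rested by (simp add: rested_bandit_def)
  have policy: "is_policy K \<pi>" using ucb by (simp add: is_R_ed_UCB_def)
  interpret interaction K \<nu> \<pi> by unfold_locales fact+
  have Y1: "1 \<le> Y" using Y(1) T by (smt (verit) ln_ge_zero of_nat_1 of_nat_mono)
  have "Max (S ` {1..K}) \<in> S ` {1..K}" using K by (intro Max_in) auto
  then obtain j where j: "j \<in> {1..K}" and best: "\<And>i. i \<in> {1..K} \<Longrightarrow> S i \<le> S j"
    using Max_ge[of "S ` {1..K}"] by fastforce
  have "S j - expected_return K \<nu> \<pi> T \<le> 2 * real K * harm T + D"
  proof (rule expected_return_ge)
    show "(\<lambda>h. \<Sum>t\<in>{1..T}. round_deviation K \<nu> \<sigma> \<epsilon> \<alpha> T t h) \<in> borel_measurable (law T)"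
      unfolding round_deviation_def measurable_cong_sets[OF sets_law refl]
      by (intro borel_measurable_sum borel_measurable_times borel_measurable_const measurable_deviation_weight)
    show "0 \<le> (\<Sum>t\<in>{1..T}. round_deviation K \<nu> \<sigma> \<epsilon> \<alpha> T t h)" for h
      by (intro sum_nonneg round_deviation_nonneg)
    show "(\<integral>\<^sup>+h. ennreal (\<Sum>t\<in>{1..T}. round_deviation K \<nu> \<sigma> \<epsilon> \<alpha> T t h) \<partial>law T) \<le> ennreal (2 * real K * harm T)"
      using pos by (intro expected_round_deviation_le interaction_axioms sub) auto
    show "0 \<le> 2 * real K * harm T" by (simp add: harm_nonneg)
    show "AE h in law T. S j - (\<Sum>t\<in>{1..T}. mean_reward \<nu> (arm_at h t) (pulls h (arm_at h t) t))
        \<le> (\<Sum>t\<in>{1..T}. round_deviation K \<nu> \<sigma> \<epsilon> \<alpha> T t h) + D"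
    proof (rule AE_mp[OF AE_law_follows_policy], rule AE_I2, rule impI)
      fix h assume "h \<in> space (law T)"
        and follows: "\<forall>t\<in>{1..T}. arm_at h t = \<pi> (t - 1) (restrict h {0..<t - 1})"
      then have h: "h \<in> space (history_space K T)" by (simp add: space_law)
      have "(\<Sum>i\<in>{1..K}. pulls h i T) = T"
        using arm_at_history_space[OF h] by (intro sum_pulls) auto
      then have "(\<Sum>i\<in>{1..K}. \<Sum>n<pulls h i T. min 1 (real T * increment \<nu> i (n - 2 * nat \<lfloor>\<epsilon> * real n\<rfloor> + 1)))
          \<le> real K * (2 / (1 - 2 * \<epsilon>) * (U + 1)) + real K"
        unfolding U_def by (rule sum_increment_cost_le[OF K rise pos(2,3) q T])
      moreover have "real K * (\<Sum>n<T. exploration_cost \<sigma> \<epsilon> \<alpha> T n) \<le> real K * (39 * (Y / \<epsilon>))"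
        unfolding Y_def using pos T Y1 Y_def by (intro mult_left_mono sum_exploration_cost_le) auto
      moreover note pathwise_regret_le[OF rested rise ucb pos(1-3) _ h follows j]
      ultimately show "S j - (\<Sum>t\<in>{1..T}. mean_reward \<nu> (arm_at h t) (pulls h (arm_at h t) t))
          \<le> (\<Sum>t\<in>{1..T}. round_deviation K \<nu> \<sigma> \<epsilon> \<alpha> T t h) + D"
        using pos(4) unfolding S_def D_def by linarith
    qed
  qed
  then have "regret K \<nu> \<pi> T \<le> 2 * real K * harm T + D"
    using regret_le[OF rested policy rise T, of "S j"] best by (simp add: S_def)
  also have "2 * real K * harm T + D = real K * (2 * harm T + 39 * (Y / \<epsilon>) + (2 / (1 - 2 * \<epsilon>) + 1)
      + 2 * (U / (1 - 2 * \<epsilon>)))"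
    by (simp add: D_def algebra_simps add_divide_distrib)
  \<comment> \<open>42 = 39 + 2 + 1: exploration, twice the harmonic sum, and the additive constant,
    the last two through \<open>Y \<le> Y / \<epsilon>\<close>.\<close>
  also have "\<dots> \<le> real K * (42 * (Y / \<epsilon>) + 42 * (U / (1 - 2 * \<epsilon>)))"
  proof (rule mult_left_mono)
    have "Y \<le> Y / \<epsilon>" using Y1 pos by (simp add: field_simps)
    moreover have "harm T \<le> Y" using harm_le_ln[OF T] Y(1) by simp
    moreover have "0 \<le> U / (1 - 2 * \<epsilon>)"
    proof -
      have "0 \<le> (MAX i\<in>{1..K}. if q = 0 then 1 else increment \<nu> i l powr q)" for l
        using K by (intro order_trans[OF _ Max_ge[of _ "if q = 0 then 1 else increment \<nu> 1 l powr q"]]) auto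
      then show ?thesis
        using pos unfolding U_def cumulative_increment_def by (intro divide_nonneg_nonneg mult_nonneg_nonneg sum_nonneg) auto
    qed
    ultimately show "2 * harm T + 39 * (Y / \<epsilon>) + (2 / (1 - 2 * \<epsilon>) + 1) + 2 * (U / (1 - 2 * \<epsilon>))
        \<le> 42 * (Y / \<epsilon>) + 42 * (U / (1 - 2 * \<epsilon>))"
      using Y(2) by linarith
  qed simp
  finally show ?thesis by (simp add: U_def algebra_simps)
qed

text \<open>The bound is asymptotic in \<open>T\<close> by necessity: at \<open>T = 1\<close> both
  terms on the right vanish, while the first pull may already miss the best arm.\<close>

theorem theorem5p2:
  shows "\<exists>C>0. \<forall>(\<sigma>::real) (\<epsilon>::real) (\<alpha>::real).
    0 < \<sigma> \<longrightarrow> 0 < \<epsilon> \<longrightarrow> \<epsilon> < 1/2 \<longrightarrow> 2 < \<alpha> \<longrightarrow>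
    (\<forall>\<^sub>F T::nat in at_top. \<forall>(K::nat) (\<nu>::bandit) (\<pi>::policy) (q::real).
       rested_bandit K \<nu> \<longrightarrow> rising K \<nu> \<longrightarrow> subgaussian_rewards K \<nu> \<sigma> \<longrightarrow>
       is_R_ed_UCB K \<sigma> \<epsilon> \<alpha> T \<pi> \<longrightarrow> 0 \<le> q \<longrightarrow> q \<le> 1 \<longrightarrow>
       regret K \<nu> \<pi> T \<le>
         C * (real K / \<epsilon> * (\<sigma> * real T) powr (2/3) * (\<alpha> * ln (real T)) powr (1/3)
              + real K * real T powr q / (1 - 2 * \<epsilon>) *
                cumulative_increment K \<nu> (nat \<lceil>(1 - 2 * \<epsilon>) * (real T / real K)\<rceil>) q))"
proof (intro exI[of _ 42] conjI allI impI)
  fix \<sigma> \<epsilon> \<alpha> :: real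
  assume pos: "0 < \<sigma>" "0 < \<epsilon>" "\<epsilon> < 1/2" "2 < \<alpha>"
  then have "0 < \<alpha>" by simp
  from eventually_horizon_large[OF pos(1) this, of "2 / (1 - 2 * \<epsilon>) + 1"]
  show "\<forall>\<^sub>F T::nat in at_top. \<forall>(K::nat) (\<nu>::bandit) (\<pi>::policy) (q::real).
       rested_bandit K \<nu> \<longrightarrow> rising K \<nu> \<longrightarrow> subgaussian_rewards K \<nu> \<sigma> \<longrightarrow>
       is_R_ed_UCB K \<sigma> \<epsilon> \<alpha> T \<pi> \<longrightarrow> 0 \<le> q \<longrightarrow> q \<le> 1 \<longrightarrow>
       regret K \<nu> \<pi> T \<le>
         42 * (real K / \<epsilon> * (\<sigma> * real T) powr (2/3) * (\<alpha> * ln (real T)) powr (1/3)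
              + real K * real T powr q / (1 - 2 * \<epsilon>) *
                cumulative_increment K \<nu> (nat \<lceil>(1 - 2 * \<epsilon>) * (real T / real K)\<rceil>) q)"
  proof (rule eventually_mono, intro allI impI)
    fix T K :: nat and \<nu> \<pi> and q :: real
    assume "1 \<le> T \<and> 1 + ln (real T) \<le> (\<sigma> * real T) powr (2/3) * (\<alpha> * ln (real T)) powr (1/3) \<and>
        2 / (1 - 2 * \<epsilon>) + 1 \<le> (\<sigma> * real T) powr (2/3) * (\<alpha> * ln (real T)) powr (1/3)"
      and "rested_bandit K \<nu>" "rising K \<nu>" "subgaussian_rewards K \<nu> \<sigma>"
        "is_R_ed_UCB K \<sigma> \<epsilon> \<alpha> T \<pi>" "0 \<le> q" "q \<le> 1"
    with pos regret_R_ed_UCB_le[of K \<nu> \<sigma> \<epsilon> \<alpha> T \<pi> q]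
    show "regret K \<nu> \<pi> T \<le>
         42 * (real K / \<epsilon> * (\<sigma> * real T) powr (2/3) * (\<alpha> * ln (real T)) powr (1/3)
              + real K * real T powr q / (1 - 2 * \<epsilon>) *
                cumulative_increment K \<nu> (nat \<lceil>(1 - 2 * \<epsilon>) * (real T / real K)\<rceil>) q)"
      by (simp only: mult.assoc)
  qed
qed simp

end
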